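(* Let $E$ be a complex Banach lattice and let $(e^{tA})_{t \in [0,\infty)}$ be a uniformly eventually positive $C_0$-semigroup on $E$ which is bounded and norm continuous at infinity. Then the following are equivalent: (i) The limit $\lim_{t \to \infty} e^{tA}f$ exists for every $f \in E$. (ii) The semigroup is mean ergodic.
   Context: A $C_0$-semigroup $(e^{tA})_{t\ge 0}$ on a complex Banach lattice $E$ is uniformly eventually positive if there exists $t_0 \ge 0$ such that $e^{tA}$ is a positive operator (i.e. $e^{tA}f \ge 0$ for all $0\le f\in E$) for every $t \ge t_0$. Let $\omega_0(A)$ denote the growth bound of the semigroup. The semigroup is called norm continuous at infinity if $\omega_0(A) > -\infty$ and the rescaled semigroup $S(t) := e^{t(A-\omega_0(A)I)}$ satisfies $\limsup_{s \to 0} \|S(t) - S(t+s)\| \to 0$ as $t \to \infty$ (the phrase "norm continuous at infinity" always tacitly includes $\omega_0(A) > -\infty$). The semigroup is called mean ergodic if for every $f \in E$ the Cesàro means $\frac{1}{t}\int_0^t e^{sA}f\,ds$ converge in norm as $t \to \infty$. *)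

theory Defs
  imports "HOL-Analysis.Analysis"
begin

class banach_lattice = banach + ordered_real_vector + lattice +
  assumes lattice_norm: "sup x (- x) \<le> sup y (- y) \<Longrightarrow> norm x \<le> norm y"

text \<open>The complex Banach lattice E is the complexification of a real Banach
  lattice E_R; its elements are pairs (x, y) standing for x + i y.
  The Banach space structure on pairs is the product one (its norm is
  equivalent to the modulus norm of the complexification).\<close>

definition cscale :: "complex \<Rightarrow> 'a::real_vector \<times> 'a \<Rightarrow> 'a \<times> 'a" where
  "cscale c f = (Re c *\<^sub>R fst f - Im c *\<^sub>R snd f, Im c *\<^sub>R fst f + Re c *\<^sub>R snd f)"

definition complex_bounded_linear :: "('a::real_normed_vector \<times> 'a \<Rightarrow> 'a \<times> 'a) \<Rightarrow> bool" where
  "complex_bounded_linear T \<longleftrightarrow> bounded_linear T \<and> (\<forall>c f. T (cscale c f) = cscale c (T f))"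

definition cpos :: "'a::{real_vector, order} \<times> 'a \<Rightarrow> bool" where
  "cpos f \<longleftrightarrow> snd f = 0 \<and> 0 \<le> fst f"

definition positive_op :: "('a::{real_vector, order} \<times> 'a \<Rightarrow> 'a \<times> 'a) \<Rightarrow> bool" where
  "positive_op T \<longleftrightarrow> (\<forall>f. cpos f \<longrightarrow> cpos (T f))"

definition C0_semigroup :: "(real \<Rightarrow> 'a::real_normed_vector \<times> 'a \<Rightarrow> 'a \<times> 'a) \<Rightarrow> bool" where
  "C0_semigroup T \<longleftrightarrow>
     (\<forall>t\<ge>0. complex_bounded_linear (T t)) \<and>
     T 0 = id \<and>
     (\<forall>s\<ge>0. \<forall>t\<ge>0. T (s + t) = T s \<circ> T t) \<and>
     (\<forall>f. continuous_on {0..} (\<lambda>t. T t f))"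

definition uniformly_eventually_positive :: "(real \<Rightarrow> 'a::{real_vector, order} \<times> 'a \<Rightarrow> 'a \<times> 'a) \<Rightarrow> bool" where
  "uniformly_eventually_positive T \<longleftrightarrow> (\<exists>t0\<ge>0. \<forall>t\<ge>t0. positive_op (T t))"

definition bounded_semigroup :: "(real \<Rightarrow> 'a::real_normed_vector \<times> 'a \<Rightarrow> 'a \<times> 'a) \<Rightarrow> bool" where
  "bounded_semigroup T \<longleftrightarrow> (\<exists>M. \<forall>t\<ge>0. onorm (T t) \<le> M)"

definition growth_bound :: "(real \<Rightarrow> 'a::real_normed_vector \<times> 'a \<Rightarrow> 'a \<times> 'a) \<Rightarrow> ereal" where
  "growth_bound T = Inf {ereal \<omega> | \<omega>. \<exists>M. \<forall>t\<ge>0. onorm (T t) \<le> M * exp (\<omega> * t)}"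

definition norm_continuous_at_infinity :: "(real \<Rightarrow> 'a::real_normed_vector \<times> 'a \<Rightarrow> 'a \<times> 'a) \<Rightarrow> bool" where
  "norm_continuous_at_infinity T \<longleftrightarrow>
     growth_bound T > - \<infinity> \<and>
     (let \<omega> = real_of_ereal (growth_bound T);
          S = (\<lambda>t f. exp (- \<omega> * t) *\<^sub>R T t f)
      in ((\<lambda>t. Limsup (at (0::real)) (\<lambda>s. ereal (onorm (\<lambda>f. S t f - S (t + s) f))))
            \<longlongrightarrow> 0) at_top)"

definition mean_ergodic :: "(real \<Rightarrow> 'a::banach \<times> 'a \<Rightarrow> 'a \<times> 'a) \<Rightarrow> bool" where
  "mean_ergodic T \<longleftrightarrow>
     (\<forall>f. \<exists>g. ((\<lambda>t. (1 / t) *\<^sub>R integral {0..t} (\<lambda>s. T s f)) \<longlongrightarrow> g) at_top)"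

end

theory Submission
  imports Defs "HOL-Library.Lattice_Algebras"
begin

text \<open>
  The heart of the matter is that \<open>T (t + s) f - T t f\<close> tends to 0 for every \<open>s\<close>; mean ergodicity
  then upgrades this to convergence, because \<open>f\<close> minus its Cesaro means is an average of vectors
  \<open>f - T s f\<close>.

  After discretising time, a positive functional on the bounded sequences in the space turns the orbits
  into a bounded two-sided trajectory of positive functionals, and it suffices that every such
  trajectory is constant. The trajectories form the positive cone of a lattice on which the shift \<open>V\<close>
  and its inverse act positively and isometrically, and norm continuity at infinity makes \<open>V\<close>
  close to the identity in norm. If \<open>f\<close> and \<open>g\<close> are disjoint and \<open>u = Vf \<and> g\<close>, then \<open>V\<^sup>-\<^sup>1u \<le> f\<close> is disjoint
  from \<open>u\<close>, which forces \<open>u = 0\<close>; so \<open>V\<close> preserves bands. For \<open>c > 1\<close>, on the band of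
  \<open>p = (Vf - cf)\<^sup>+\<close> the iterates \<open>V\<^sup>n f\<close> dominate \<open>c\<^sup>n f\<close>, so boundedness gives \<open>p = 0\<close>. Hence
  \<open>Vf \<le> f\<close>, and telescoping gives \<open>Vf = f\<close>.
\<close>

\<comment> \<open>Positive parts, monotone norm and Riesz decomposition in a Banach lattice\<close>
subclass (in banach_lattice) lattice_ab_group_add ..

lemma norm_mono_nonneg:
  fixes x y :: "'a::banach_lattice"
  assumes "0 \<le> x" "x \<le> y"
  shows "norm x \<le> norm y"
proof (rule lattice_norm)
  have "- x \<le> x" "- y \<le> y"
    using assms by (auto intro: order_trans[of _ 0] simp: neg_le_0_iff_le)
  then show "sup x (- x) \<le> sup y (- y)"
    using assms by (simp add: sup_absorb1)
qed

lemma norm_pprt_le: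
  fixes x :: "'a::banach_lattice"
  shows "norm (pprt x) \<le> norm x"
proof (rule lattice_norm)
  have *: "- pprt x \<le> pprt x"
    by (meson neg_le_0_iff_le order_trans zero_le_pprt)
  have "0 \<le> sup x (- x)"
  proof -
    have "x + - x \<le> sup x (- x) + sup x (- x)"
      by (intro add_mono) auto
    then show ?thesis
      by (simp only: right_minus zero_le_double_add_iff_zero_le_single_add)
  qed
  then show "sup (pprt x) (- pprt x) \<le> sup x (- x)"
    using * by (simp add: sup_absorb1 pprt_def)
qed

lemma pprt_add_le:
  fixes x y :: "'a::banach_lattice"
  shows "pprt (x + y) \<le> pprt x + pprt y"
  unfolding pprt_def by (intro sup_least add_mono add_nonneg_nonneg) auto

lemma pprt_scaleR_pos:
  fixes x :: "'a::banach_lattice"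
  assumes "0 < c"
  shows "pprt (c *\<^sub>R x) = c *\<^sub>R pprt x"
proof (rule antisym)
  show "pprt (c *\<^sub>R x) \<le> c *\<^sub>R pprt x"
    using assms by (auto simp: pprt_def intro!: scaleR_left_mono scaleR_nonneg_nonneg)
  have "pprt x \<le> (1/c) *\<^sub>R pprt (c *\<^sub>R x)"
  proof -
    have "(1/c) *\<^sub>R (c *\<^sub>R x) \<le> (1/c) *\<^sub>R pprt (c *\<^sub>R x)"
      using assms by (intro scaleR_left_mono) (auto simp: pprt_def)
    then show ?thesis
      using assms by (subst pprt_def) (auto intro!: scaleR_nonneg_nonneg)
  qed
  then have "c *\<^sub>R pprt x \<le> c *\<^sub>R (1/c) *\<^sub>R pprt (c *\<^sub>R x)"
    using assms by (intro scaleR_left_mono) auto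
  then show "c *\<^sub>R pprt x \<le> pprt (c *\<^sub>R x)"
    using assms by simp
qed

lemma pprt_minus_pprt:
  fixes x :: "'a::banach_lattice"
  shows "x = pprt x - pprt (- x)"
  using prts[of x] by (simp add: pprt_neg)

lemma riesz_decomposition:
  fixes y a b :: "'a::banach_lattice"
  assumes "0 \<le> y" "y \<le> a + b" "0 \<le> a" "0 \<le> b"
  obtains y1 y2 where "y = y1 + y2" "0 \<le> y1" "y1 \<le> a" "0 \<le> y2" "y2 \<le> b"
proof (rule that)
  \<comment> \<open>The first summand is \<open>inf y a\<close>, the largest part of
    \<open>y\<close> that fits under \<open>a\<close>. This equation also fixes the witnesses for
    the remaining goals.\<close>
  show "y = inf y a + (y - inf y a)"
    by (subst add.commute) (rule diff_add_cancel[symmetric])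
  have "y - b \<le> inf y a"
    using assms by (simp add: algebra_simps)
  then show "y - inf y a \<le> b" by (simp only: diff_le_eq add.commute)
  show "0 \<le> y - inf y a" by (simp only: diff_ge_0_iff_ge inf_le1)
qed (use assms in auto)

section \<open>The Hahn-Banach theorem\<close>

definition sublinear :: "('v::real_vector \<Rightarrow> real) \<Rightarrow> bool" where
  "sublinear p \<longleftrightarrow> (\<forall>x y. p (x + y) \<le> p x + p y) \<and> (\<forall>c>0. \<forall>x. p (c *\<^sub>R x) = c * p x)"

lemma sublinearD:
  assumes "sublinear p"
  shows sublinear_add: "p (x + y) \<le> p x + p y"
    and sublinear_scaleR: "0 < c \<Longrightarrow> p (c *\<^sub>R x) = c * p x"
    and sublinear_zero: "p 0 = 0"
    and sublinear_minus: "- p (- x) \<le> p x"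
proof -
  show "p (x + y) \<le> p x + p y" "0 < c \<Longrightarrow> p (c *\<^sub>R x) = c * p x"
    using assms by (auto simp: sublinear_def)
  have "p (2 *\<^sub>R 0) = 2 * p 0"
    using assms unfolding sublinear_def by (metis zero_less_numeral)
  then show 0: "p 0 = 0" by simp
  have "p (x + - x) \<le> p x + p (- x)"
    using assms unfolding sublinear_def by blast
  then show "- p (- x) \<le> p x" using 0 by simp
qed

text \<open>\<open>q\<close> is the largest sublinear minorant of \<open>p\<close> with
  \<open>q (- y) \<le> - p y\<close>. Taking \<open>t = 0\<close> gives \<open>q \<le> p\<close>;
  taking \<open>t = 1\<close> gives the two remaining bounds, the last of which makes minimal
  functionals additive.\<close>

lemma sublinear_refine:
  fixes p :: "'v::real_vector \<Rightarrow> real"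
  assumes p: "sublinear p"
  obtains q where "sublinear q" "q \<le> p" "q (- y) \<le> - p y" "\<And>x. q x \<le> p (x + y) - p y"
proof -
  define q where "q x = (INF t\<in>{0..}. p (x + t *\<^sub>R y) - t * p y)" for x
  \<comment> \<open>A lower bound independent of \<open>t\<close>, so that the infimum is
    finite.\<close>
  have low: "- p (- x) \<le> p (x + t *\<^sub>R y) - t * p y" if "0 \<le> t" for x t
  proof -
    have "p (t *\<^sub>R y) = t * p y"
      using that p sublinear_scaleR[OF p] sublinear_zero[OF p] by (cases "t = 0") auto
    moreover have "p (t *\<^sub>R y) \<le> p (x + t *\<^sub>R y) + p (- x)"
      using sublinear_add[OF p, of "x + t *\<^sub>R y" "- x"] by simp
    ultimately show ?thesis by linarith
  qed
  have bdd: "bdd_below ((\<lambda>t. p (x + t *\<^sub>R y) - t * p y) ` {0..})" for x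
    using low by (auto intro!: bdd_belowI2[of _ "- p (- x)"])
  have le: "q x \<le> p (x + t *\<^sub>R y) - t * p y" if "0 \<le> t" for x t
    unfolding q_def using that by (intro cINF_lower[OF bdd]) auto
  have ge: "c \<le> q x" if "\<And>t. 0 \<le> t \<Longrightarrow> c \<le> p (x + t *\<^sub>R y) - t * p y" for c x
    unfolding q_def by (rule cINF_greatest) (use that in auto)
  have sub: "q (x + z) \<le> q x + q z" for x z
  proof -
    have "q (x + z) - (p (z + s *\<^sub>R y) - s * p y) \<le> q x" if s: "0 \<le> s" for s
    proof (rule ge)
      fix t :: real assume t: "0 \<le> t"
      have "q (x + z) \<le> p ((x + z) + (t + s) *\<^sub>R y) - (t + s) * p y"
        using s t by (intro le) auto
      also have "(x + z) + (t + s) *\<^sub>R y = (x + t *\<^sub>R y) + (z + s *\<^sub>R y)"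
        by (simp add: algebra_simps)
      finally show "q (x + z) - (p (z + s *\<^sub>R y) - s * p y) \<le> p (x + t *\<^sub>R y) - t * p y"
        using sublinear_add[OF p, of "x + t *\<^sub>R y" "z + s *\<^sub>R y"] by (simp add: algebra_simps)
    qed
    then have "q (x + z) - q x \<le> p (z + s *\<^sub>R y) - s * p y" if "0 \<le> s" for s
      using that by (smt (verit))
    then have "q (x + z) - q x \<le> q z" by (rule ge)
    then show ?thesis by simp
  qed
  have scle: "q (c *\<^sub>R x) \<le> c * q x" if c: "0 < c" for c x
  proof -
    have "q (c *\<^sub>R x) / c \<le> q x"
    proof (rule ge)
      fix t :: real assume t: "0 \<le> t"
      have "q (c *\<^sub>R x) \<le> p (c *\<^sub>R x + (c * t) *\<^sub>R y) - (c * t) * p y"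
        using c t by (intro le) auto
      also have "c *\<^sub>R x + (c * t) *\<^sub>R y = c *\<^sub>R (x + t *\<^sub>R y)"
        by (simp add: algebra_simps)
      finally show "q (c *\<^sub>R x) / c \<le> p (x + t *\<^sub>R y) - t * p y"
        using c by (simp only: sublinear_scaleR[OF p c]) (simp add: field_simps)
    qed
    then show ?thesis using c by (simp add: field_simps)
  qed
  have sc: "q (c *\<^sub>R x) = c * q x" if c: "0 < c" for c x
  proof (rule antisym[OF scle[OF c]])
    have "q ((1/c) *\<^sub>R c *\<^sub>R x) \<le> (1/c) * q (c *\<^sub>R x)"
      using c by (intro scle) auto
    then show "c * q x \<le> q (c *\<^sub>R x)"
      using c by (simp add: field_simps)
  qed
  show thesis
  proof (rule that[of q])
    show "sublinear q" unfolding sublinear_def using sub sc by blast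
    show "q \<le> p" using le[of 0] by (auto simp: le_fun_def)
    show "q (- y) \<le> - p y" using le[of 1 "- y"] sublinear_zero[OF p] by simp
    show "q x \<le> p (x + y) - p y" for x using le[of 1 x] by simp
  qed
qed

text \<open>Zorn's lemma: the pointwise infimum of a nonempty chain of sublinear minorants is again
  sublinear, and it is finite because every member is at least \<open>- p (- x)\<close> at
  \<open>x\<close>.\<close>

lemma minimal_sublinear_exists:
  fixes p :: "'v::real_vector \<Rightarrow> real"
  assumes p: "sublinear p"
  obtains m where "sublinear m" "m \<le> p" "\<And>q. sublinear q \<Longrightarrow> q \<le> m \<Longrightarrow> q = m"
proof -
  define S where "S = {q. sublinear q \<and> q \<le> p}"
  \<comment> \<open>The order is reversed, so that a maximal element for Zorn's lemma is a minimal
    functional.\<close>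
  define r where "r = {(q, q'). q \<in> S \<and> q' \<in> S \<and> q' \<le> q}"
  have F: "Field r = S" unfolding r_def Field_def by auto
  have po: "Partial_order r"
    unfolding partial_order_on_def preorder_on_def F
    by (auto simp: r_def refl_on_def trans_def antisym_def)
  have "\<exists>u\<in>Field r. \<forall>a\<in>C. (a, u) \<in> r" if C: "C \<in> Chains r" for C
  proof (cases "C = {}")
    case True
    then show ?thesis using p by (auto simp: F S_def)
  next
    case False
    have CS: "C \<subseteq> S" and tot: "\<And>a b. a \<in> C \<Longrightarrow> b \<in> C \<Longrightarrow> a \<le> b \<or> b \<le> a"
      using C by (auto simp: Chains_def r_def)
    define u where "u x = (INF q\<in>C. q x)" for x
    have bdd: "bdd_below ((\<lambda>q. q x) ` C)" for x
    proof (rule bdd_belowI2)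
      fix q assume "q \<in> C"
      then have "sublinear q" "q (- x) \<le> p (- x)"
        using CS by (auto simp: S_def le_fun_def)
      then show "- p (- x) \<le> q x"
        using sublinear_minus[of q x] by linarith
    qed
    have le: "u x \<le> q x" if "q \<in> C" for q x
      unfolding u_def using that by (intro cINF_lower[OF bdd])
    have ge: "c \<le> u x" if "\<And>q. q \<in> C \<Longrightarrow> c \<le> q x" for c x
      unfolding u_def by (rule cINF_greatest) (use that False in auto)
    have sub: "u (x + z) \<le> u x + u z" for x z
    proof -
      have "u (x + z) - b z \<le> u x" if b: "b \<in> C" for b
      proof (rule ge)
        fix a assume a: "a \<in> C"
        \<comment> \<open>In a chain the smaller of \<open>a\<close> and \<open>b\<close> is a
          common minorant, so subadditivity survives the infimum.\<close>
        obtain d where d: "d \<in> C" "d \<le> a" "d \<le> b"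
          using tot[OF a b] a b by blast
        have "u (x + z) \<le> d (x + z)" using d le by blast
        also have "\<dots> \<le> d x + d z"
          using d CS by (intro sublinear_add) (auto simp: S_def)
        also have "\<dots> \<le> a x + b z" using d by (intro add_mono) (auto simp: le_fun_def)
        finally show "u (x + z) - b z \<le> a x" by simp
      qed
      then have "u (x + z) - u x \<le> b z" if "b \<in> C" for b
        using that by (smt (verit))
      then have "u (x + z) - u x \<le> u z" by (rule ge)
      then show ?thesis by simp
    qed
    have scle: "u (c *\<^sub>R x) \<le> c * u x" if c: "0 < c" for c x
    proof -
      have "u (c *\<^sub>R x) / c \<le> u x"
      proof (rule ge)
        fix a assume a: "a \<in> C"
        then have "sublinear a" using CS by (auto simp: S_def)
        then show "u (c *\<^sub>R x) / c \<le> a x"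
          using le[OF a, of "c *\<^sub>R x"] c by (simp add: sublinear_scaleR field_simps)
      qed
      then show ?thesis using c by (simp add: field_simps)
    qed
    have sc: "u (c *\<^sub>R x) = c * u x" if c: "0 < c" for c x
    proof (rule antisym[OF scle[OF c]])
      have "u ((1/c) *\<^sub>R c *\<^sub>R x) \<le> (1/c) * u (c *\<^sub>R x)"
        using c by (intro scle) auto
      then show "c * u x \<le> u (c *\<^sub>R x)"
        using c by (simp add: field_simps)
    qed
    obtain q0 where q0: "q0 \<in> C" using False by blast
    have "u \<le> p"
      using le[OF q0] q0 CS by (force simp: le_fun_def S_def intro: order_trans)
    then have "u \<in> S" using sub sc by (auto simp: S_def sublinear_def)
    then show ?thesis
      using CS le unfolding F by (intro bexI[of _ u]) (auto simp: r_def le_fun_def)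
  qed
  then obtain m where m: "m \<in> Field r" "\<forall>a\<in>Field r. (m, a) \<in> r \<longrightarrow> a = m"
    using Zorns_po_lemma[OF po] by blast
  show thesis
  proof (rule that[of m])
    show "sublinear m" "m \<le> p" using m(1) by (auto simp: F S_def)
    show "q = m" if "sublinear q" "q \<le> m" for q
      using m that unfolding F by (auto simp: S_def r_def)
  qed
qed

text \<open>A minimal sublinear functional is additive, since no refinement makes it smaller.\<close>

theorem hahn_banach_sublinear:
  fixes p :: "'v::real_vector \<Rightarrow> real"
  assumes p: "sublinear p"
  obtains \<phi> where "linear \<phi>" "\<phi> \<le> p" "\<phi> y = p y"
proof -
  \<comment> \<open>Refining along \<open>y\<close> before minimising pins the value at
    \<open>y\<close>: \<open>m (- y) \<le> q (- y) \<le> - p y\<close>, and additivity of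
    \<open>m\<close> turns this into \<open>p y \<le> m y\<close>.\<close>
  obtain q where q: "sublinear q" "q \<le> p" "q (- y) \<le> - p y"
    using sublinear_refine[OF p] by metis
  obtain m where m: "sublinear m" "m \<le> q" and min: "\<And>q. sublinear q \<Longrightarrow> q \<le> m \<Longrightarrow> q = m"
    using minimal_sublinear_exists[OF q(1)] by metis
  have add: "m (x + z) = m x + m z" for x z
  proof (rule antisym[OF sublinear_add[OF m(1)]])
    \<comment> \<open>Refining \<open>m\<close> along \<open>z\<close> cannot lower it, so
      \<open>q' = m\<close>, and the bound on \<open>q' x\<close> is superadditivity.\<close>
    obtain q' where "sublinear q'" "q' \<le> m" "q' x \<le> m (x + z) - m z"
      using sublinear_refine[OF m(1)] by metis
    with min[of q'] show "m x + m z \<le> m (x + z)" by simp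
  qed
  have neg: "m (- x) = - m x" for x
    using add[of x "- x"] sublinear_zero[OF m(1)] by simp
  have "m (c *\<^sub>R x) = c *\<^sub>R m x" for c x
  proof (cases c "0::real" rule: linorder_cases)
    case less
    then have "m ((- c) *\<^sub>R x) = - c * m x" by (intro sublinear_scaleR[OF m(1)]) auto
    then show ?thesis using neg[of "c *\<^sub>R x"] by simp
  qed (auto simp: sublinear_scaleR[OF m(1)] sublinear_zero[OF m(1)])
  then have "linear m" using add by (intro linearI)
  moreover have "m \<le> p" using m(2) q(2) by (rule order_trans)
  moreover have "p y \<le> m y"
    using m(2) q(3) neg[of y] by (force simp: le_fun_def dest: spec[of _ "- y"])
  ultimately show thesis
    using that by (metis antisym le_funD)
qed

section \<open>The lattice of trajectories\<close>

text \<open>\<open>R n\<close> models the semigroup at time \<open>n * h\<close>, acting on the real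
  lattice. Its laws are required from \<open>N0\<close> on only, since earlier operators need be
  neither positive nor real. From \<open>N1\<close> on, one step changes \<open>R n\<close> by at
  most \<open>\<epsilon>\<close> in norm; \<open>M * \<epsilon> < 1\<close> makes the bootstrap in
  \<open>disjoint_shift\<close> contract.\<close>

locale eventually_positive_powers =
  fixes R :: "nat \<Rightarrow> 'a::banach_lattice \<Rightarrow> 'a" and N0 N1 :: nat and M \<epsilon> :: real
  assumes R_add: "N0 \<le> n \<Longrightarrow> R n (x + y) = R n x + R n y"
    and R_nonneg: "N0 \<le> n \<Longrightarrow> 0 \<le> x \<Longrightarrow> 0 \<le> R n x"
    and R_norm: "N0 \<le> n \<Longrightarrow> norm (R n x) \<le> M * norm x"
    and R_semigroup: "N0 \<le> m \<Longrightarrow> N0 \<le> n \<Longrightarrow> R (m + n) x = R m (R n x)"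
    and R_step: "N1 \<le> n \<Longrightarrow> norm (R (Suc n) x - R n x) \<le> \<epsilon> * norm x"
    and M_nonneg: "0 \<le> M" and eps_nonneg: "0 \<le> \<epsilon>" and M_eps: "M * \<epsilon> < 1"
begin

lemma R_diff: "N0 \<le> n \<Longrightarrow> R n (x - y) = R n x - R n y"
  using R_add[of n "x - y" y] by (simp add: algebra_simps)

lemma R_mono: "N0 \<le> n \<Longrightarrow> x \<le> y \<Longrightarrow> R n x \<le> R n y"
  using R_nonneg[of n "y - x"] R_diff[of n y x] by (simp add: algebra_simps)

text \<open>\<open>\<phi> (k + int n)\<close> is the image of the positive functional
  \<open>\<phi> k\<close> under the adjoint of \<open>R n\<close>. Time is two-sided so that the
  shift \<open>\<lambda>k. \<phi> (k + 1)\<close> is invertible with positive inverse, hence a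
  lattice isomorphism, which the adjoint of \<open>R n\<close> alone need not be.\<close>

definition trajectory :: "(int \<Rightarrow> 'a \<Rightarrow> real) \<Rightarrow> bool" where
  "trajectory \<phi> \<longleftrightarrow>
     (\<forall>k. \<forall>x\<ge>0. 0 \<le> \<phi> k x) \<and>
     (\<forall>k. \<forall>x\<ge>0. \<forall>y\<ge>0. \<phi> k (x + y) = \<phi> k x + \<phi> k y) \<and>
     (\<exists>C. \<forall>k. \<forall>x\<ge>0. \<phi> k x \<le> C * norm x) \<and>
     (\<forall>k. \<forall>n\<ge>N0. \<forall>x\<ge>0. \<phi> (k + int n) x = \<phi> k (R n x))"

text \<open>The values of a trajectory outside the positive cone are junk, so trajectories are compared on
  the cone only.\<close>

definition below :: "(int \<Rightarrow> 'a \<Rightarrow> real) \<Rightarrow> (int \<Rightarrow> 'a \<Rightarrow> real) \<Rightarrow> bool"  (infix "\<preceq>" 50) where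
  "\<phi> \<preceq> \<psi> \<longleftrightarrow> (\<forall>k. \<forall>x\<ge>0. \<phi> k x \<le> \<psi> k x)"

text \<open>This is vanishing of the meet in the lattice of trajectories, not of the meet at each
  single time. Trajectories are nonnegative on the cone, so lying below zero there means vanishing
  there.\<close>

definition disjoint :: "(int \<Rightarrow> 'a \<Rightarrow> real) \<Rightarrow> (int \<Rightarrow> 'a \<Rightarrow> real) \<Rightarrow> bool" where
  "disjoint \<phi> \<psi> \<longleftrightarrow> (\<forall>\<theta>. trajectory \<theta> \<longrightarrow> \<theta> \<preceq> \<phi> \<longrightarrow> \<theta> \<preceq> \<psi> \<longrightarrow> \<theta> \<preceq> (\<lambda>k x. 0))"

section \<open>Order and elementary rules for trajectories\<close>

lemma below_refl: "\<phi> \<preceq> \<phi>"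
  by (simp add: below_def)

lemma below_trans: "\<phi> \<preceq> \<psi> \<Longrightarrow> \<psi> \<preceq> \<theta> \<Longrightarrow> \<phi> \<preceq> \<theta>"
  unfolding below_def by (meson order_trans)

lemma disjointD: "disjoint \<phi> \<psi> \<Longrightarrow> trajectory \<theta> \<Longrightarrow> \<theta> \<preceq> \<phi> \<Longrightarrow> \<theta> \<preceq> \<psi> \<Longrightarrow> \<theta> \<preceq> (\<lambda>k x. 0)"
  unfolding disjoint_def by blast

lemma disjoint_mono: "disjoint \<phi> \<psi> \<Longrightarrow> \<phi>' \<preceq> \<phi> \<Longrightarrow> \<psi>' \<preceq> \<psi> \<Longrightarrow> disjoint \<phi>' \<psi>'"
  unfolding disjoint_def by (meson below_trans)

lemma disjoint_sym: "disjoint \<phi> \<psi> \<Longrightarrow> disjoint \<psi> \<phi>"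
  unfolding disjoint_def by blast

lemma
  assumes "trajectory \<phi>"
  shows trajectory_nonneg: "0 \<le> x \<Longrightarrow> 0 \<le> \<phi> k x"
    and trajectory_add: "0 \<le> x \<Longrightarrow> 0 \<le> y \<Longrightarrow> \<phi> k (x + y) = \<phi> k x + \<phi> k y"
    and trajectory_flow: "N0 \<le> n \<Longrightarrow> 0 \<le> x \<Longrightarrow> \<phi> (k + int n) x = \<phi> k (R n x)"
  using assms unfolding trajectory_def by blast+

text \<open>The value at time \<open>k\<close> can be read at any time \<open>k - int n\<close> with
  \<open>N0 \<le> n\<close>, after pushing the argument forward by \<open>R n\<close>.\<close>

lemma trajectory_back:
  assumes "trajectory \<phi>" "N0 \<le> n" "0 \<le> x"
  shows "\<phi> (k - int n) (R n x) = \<phi> k x"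
  using trajectory_flow[OF assms, of "k - int n"] by simp

lemma trajectory_diff:
  assumes "trajectory \<phi>" "0 \<le> x" "x \<le> y"
  shows "\<phi> k (y - x) = \<phi> k y - \<phi> k x"
  using trajectory_add[OF assms(1), of "y - x" x k] assms by simp

lemma trajectory_zero: "trajectory \<phi> \<Longrightarrow> \<phi> k 0 = 0"
  using trajectory_add[of \<phi> 0 0 k] by simp

lemma trajectory_mono: "trajectory \<phi> \<Longrightarrow> 0 \<le> x \<Longrightarrow> x \<le> y \<Longrightarrow> \<phi> k x \<le> \<phi> k y"
  using trajectory_diff[of \<phi> x y k] trajectory_nonneg[of \<phi> "y - x" k] by simp

lemma trajectory_bound:
  assumes "trajectory \<phi>"
  obtains C where "0 \<le> C" "\<And>k x. 0 \<le> x \<Longrightarrow> \<phi> k x \<le> C * norm x"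
proof -
  obtain C where C: "\<And>k x. 0 \<le> x \<Longrightarrow> \<phi> k x \<le> C * norm x"
    using assms unfolding trajectory_def by blast
  show thesis
  proof (rule that[of "\<bar>C\<bar>"])
    fix k and x :: 'a assume "0 \<le> x"
    then show "\<phi> k x \<le> \<bar>C\<bar> * norm x"
      using C[of x k] by (meson abs_ge_self mult_right_mono norm_ge_zero order_trans)
  qed simp
qed

lemma trajectory_sum:
  assumes "trajectory \<phi>" "trajectory \<psi>"
  shows "trajectory (\<lambda>k x. \<phi> k x + \<psi> k x)"
proof -
  obtain C where C: "\<And>k x. 0 \<le> x \<Longrightarrow> \<phi> k x \<le> C * norm x"
    using trajectory_bound[OF assms(1)] by metis
  obtain D where D: "\<And>k x. 0 \<le> x \<Longrightarrow> \<psi> k x \<le> D * norm x"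
    using trajectory_bound[OF assms(2)] by metis
  have "\<forall>k. \<forall>x\<ge>0. \<phi> k x + \<psi> k x \<le> (C + D) * norm x"
    using C D by (simp add: distrib_right add_mono)
  then show ?thesis
    using assms unfolding trajectory_def by (auto simp: add_nonneg_nonneg)
qed

lemma trajectory_scale:
  assumes "trajectory \<phi>" "0 \<le> c"
  shows "trajectory (\<lambda>k x. c * \<phi> k x)"
proof -
  obtain C where C: "\<And>k x. 0 \<le> x \<Longrightarrow> \<phi> k x \<le> C * norm x"
    using trajectory_bound[OF assms(1)] by metis
  have "\<forall>k. \<forall>x\<ge>0. c * \<phi> k x \<le> (c * C) * norm x"
    using C assms(2) by (simp add: mult_left_mono mult.assoc)
  then show ?thesis
    using assms unfolding trajectory_def by (auto simp: distrib_left)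
qed

lemma trajectory_subtract:
  assumes "trajectory \<phi>" "trajectory \<psi>" "\<psi> \<preceq> \<phi>"
  shows "trajectory (\<lambda>k x. \<phi> k x - \<psi> k x)"
proof -
  obtain C where C: "\<And>k x. 0 \<le> x \<Longrightarrow> \<phi> k x \<le> C * norm x"
    using trajectory_bound[OF assms(1)] by metis
  have "\<phi> k x - \<psi> k x \<le> C * norm x" if "0 \<le> x" for k x
    using C[OF that, of k] trajectory_nonneg[OF assms(2) that, of k] by linarith
  then show ?thesis
    using assms unfolding trajectory_def below_def by auto
qed

lemma trajectory_shift:
  assumes "trajectory \<phi>"
  shows "trajectory (\<lambda>k. \<phi> (k + j))"
proof -
  have "\<phi> (k + int n + j) x = \<phi> (k + j) (R n x)" if "N0 \<le> n" "0 \<le> x" for k n x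
    using trajectory_flow[OF assms that, of "k + j"] by (simp add: ac_simps)
  moreover obtain C where "\<And>k x. 0 \<le> x \<Longrightarrow> \<phi> k x \<le> C * norm x"
    using trajectory_bound[OF assms] by metis
  ultimately show ?thesis
    using trajectory_nonneg[OF assms] trajectory_add[OF assms] unfolding trajectory_def
    by (intro conjI exI[of _ C] allI impI)
qed

section \<open>Meets and disjointness of trajectories\<close>

text \<open>The Riesz-Kantorovich meet of \<open>\<phi> (k - n)\<close> and \<open>\<psi> (k - n)\<close>, pulled back along \<open>R n\<close>, decreases in
  \<open>n\<close>; the meet of the trajectories is its infimum over \<open>n\<close>.\<close>

definition splits :: "(int \<Rightarrow> 'a \<Rightarrow> real) \<Rightarrow> (int \<Rightarrow> 'a \<Rightarrow> real) \<Rightarrow> int \<Rightarrow> 'a \<Rightarrow> real set" where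
  "splits \<phi> \<psi> k x =
     {\<phi> (k - int n) y + \<psi> (k - int n) (R n x - y) | n y. N0 \<le> n \<and> 0 \<le> y \<and> y \<le> R n x}"

definition meet :: "(int \<Rightarrow> 'a \<Rightarrow> real) \<Rightarrow> (int \<Rightarrow> 'a \<Rightarrow> real) \<Rightarrow> int \<Rightarrow> 'a \<Rightarrow> real" where
  "meet \<phi> \<psi> k x = Inf (splits \<phi> \<psi> k x)"

context
  fixes \<phi> \<psi>
  assumes \<phi>: "trajectory \<phi>" and \<psi>: "trajectory \<psi>"
begin

lemma split_nonneg:
  assumes "0 \<le> y" "y \<le> R n x"
  shows "0 \<le> \<phi> (k - int n) y + \<psi> (k - int n) (R n x - y)"
  using assms by (intro add_nonneg_nonneg trajectory_nonneg \<phi> \<psi>) auto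

lemma bdd_below_splits: "bdd_below (splits \<phi> \<psi> k x)"
  by (rule bdd_belowI[of _ 0]) (auto simp: splits_def split_nonneg)

lemma meet_le:
  assumes "N0 \<le> n" "0 \<le> y" "y \<le> R n x"
  shows "meet \<phi> \<psi> k x \<le> \<phi> (k - int n) y + \<psi> (k - int n) (R n x - y)"
  unfolding meet_def by (rule cInf_lower[OF _ bdd_below_splits]) (use assms in \<open>auto simp: splits_def\<close>)

lemma splits_nonempty:
  assumes "0 \<le> x"
  shows "splits \<phi> \<psi> k x \<noteq> {}"
  unfolding splits_def using R_nonneg[of N0 x] assms by blast

lemma le_meet:
  assumes "0 \<le> x"
    and "\<And>n y. N0 \<le> n \<Longrightarrow> 0 \<le> y \<Longrightarrow> y \<le> R n x \<Longrightarrow>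
      c \<le> \<phi> (k - int n) y + \<psi> (k - int n) (R n x - y)"
  shows "c \<le> meet \<phi> \<psi> k x"
  unfolding meet_def
  by (rule cInf_greatest[OF splits_nonempty[OF assms(1)]]) (use assms in \<open>auto simp: splits_def\<close>)

lemma meet_approx:
  assumes "0 \<le> x" "meet \<phi> \<psi> k x < c"
  obtains n y where "N0 \<le> n" "0 \<le> y" "y \<le> R n x"
    "\<phi> (k - int n) y + \<psi> (k - int n) (R n x - y) < c"
  using cInf_lessD[OF splits_nonempty[OF assms(1)] assms(2)[unfolded meet_def]]
  by (auto simp: splits_def)

lemma split_push:
  assumes "0 \<le> x" "N0 \<le> n" "N0 \<le> j" "0 \<le> y" "y \<le> R n x"
  shows "0 \<le> R j y" "R j y \<le> R (j + n) x"
  using assms by (auto simp: R_nonneg R_semigroup R_mono)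

text \<open>Pushing by \<open>R j\<close> turns a split of \<open>R n x\<close> into a split of
  \<open>R (j + n) x\<close> without changing its value, by \<open>trajectory_back\<close>. Thus
  splits found at different levels can be compared at a common one.\<close>

lemma split_push_value:
  assumes "0 \<le> x" "N0 \<le> n" "N0 \<le> j" "0 \<le> y" "y \<le> R n x"
  shows "\<phi> (k - int (j + n)) (R j y) + \<psi> (k - int (j + n)) (R (j + n) x - R j y)
       = \<phi> (k - int n) y + \<psi> (k - int n) (R n x - y)"
proof -
  have 1: "R (j + n) x - R j y = R j (R n x - y)"
    using assms by (simp add: R_semigroup R_diff)
  have 2: "k - int (j + n) = k - int n - int j" by simp
  show ?thesis
    unfolding 1 2 using assms trajectory_back[OF \<phi>, of j y "k - int n"]
      trajectory_back[OF \<psi>, of j "R n x - y" "k - int n"] by simp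
qed

lemma meet_below1: "meet \<phi> \<psi> \<preceq> \<phi>"
  unfolding below_def
proof (intro allI impI)
  fix k and x :: 'a assume "0 \<le> x"
  then show "meet \<phi> \<psi> k x \<le> \<phi> k x"
    using meet_le[of N0 "R N0 x" x k] R_nonneg[of N0 x] trajectory_back[OF \<phi>, of N0 x k]
    by (simp add: trajectory_zero[OF \<psi>])
qed

lemma meet_below2: "meet \<phi> \<psi> \<preceq> \<psi>"
  unfolding below_def
proof (intro allI impI)
  fix k and x :: 'a assume "0 \<le> x"
  then show "meet \<phi> \<psi> k x \<le> \<psi> k x"
    using meet_le[of N0 0 x k] R_nonneg[of N0 x] trajectory_back[OF \<psi>, of N0 x k]
    by (simp add: trajectory_zero[OF \<phi>])
qed

text \<open>Riesz decomposition cuts a split of \<open>R n (x1 + x2)\<close> into splits for the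
  summands, which gives superadditivity. Conversely, nearly optimal splits for \<open>x1\<close> and
  \<open>x2\<close> are pushed to the common level \<open>n1 + n2\<close> and added.\<close>

lemma meet_add:
  assumes x: "0 \<le> x1" "0 \<le> x2"
  shows "meet \<phi> \<psi> k (x1 + x2) = meet \<phi> \<psi> k x1 + meet \<phi> \<psi> k x2"
proof (rule antisym)
  show "meet \<phi> \<psi> k x1 + meet \<phi> \<psi> k x2 \<le> meet \<phi> \<psi> k (x1 + x2)"
  proof (rule le_meet)
    fix n y assume n: "N0 \<le> n" and y: "0 \<le> y" "y \<le> R n (x1 + x2)"
    from n y x obtain y1 y2 where *: "y = y1 + y2" "0 \<le> y1" "y1 \<le> R n x1" "0 \<le> y2" "y2 \<le> R n x2"
      using riesz_decomposition[of y "R n x1" "R n x2"] by (auto simp: R_add R_nonneg)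
    have eq: "R n (x1 + x2) - y = (R n x1 - y1) + (R n x2 - y2)"
      using n by (simp add: R_add * algebra_simps)
    have "\<phi> (k - int n) y = \<phi> (k - int n) y1 + \<phi> (k - int n) y2"
      unfolding *(1) using * by (intro trajectory_add[OF \<phi>]) auto
    moreover have "\<psi> (k - int n) (R n (x1 + x2) - y)
        = \<psi> (k - int n) (R n x1 - y1) + \<psi> (k - int n) (R n x2 - y2)"
      unfolding eq using * by (intro trajectory_add[OF \<psi>]) auto
    moreover have "meet \<phi> \<psi> k x1 \<le> \<phi> (k - int n) y1 + \<psi> (k - int n) (R n x1 - y1)"
      "meet \<phi> \<psi> k x2 \<le> \<phi> (k - int n) y2 + \<psi> (k - int n) (R n x2 - y2)"
      using n * by (auto intro: meet_le)
    ultimately show "meet \<phi> \<psi> k x1 + meet \<phi> \<psi> k x2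
        \<le> \<phi> (k - int n) y + \<psi> (k - int n) (R n (x1 + x2) - y)"
      by linarith
  qed (use x in auto)
  show "meet \<phi> \<psi> k (x1 + x2) \<le> meet \<phi> \<psi> k x1 + meet \<phi> \<psi> k x2"
  proof (rule field_le_epsilon)
    fix e :: real assume e: "0 < e"
    have "meet \<phi> \<psi> k x1 < meet \<phi> \<psi> k x1 + e/2" using e by simp
    from meet_approx[OF x(1) this] obtain n1 y1 where 1: "N0 \<le> n1" "0 \<le> y1" "y1 \<le> R n1 x1"
      "\<phi> (k - int n1) y1 + \<psi> (k - int n1) (R n1 x1 - y1) < meet \<phi> \<psi> k x1 + e/2" .
    have "meet \<phi> \<psi> k x2 < meet \<phi> \<psi> k x2 + e/2" using e by simp
    from meet_approx[OF x(2) this] obtain n2 y2 where 2: "N0 \<le> n2" "0 \<le> y2" "y2 \<le> R n2 x2"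
      "\<phi> (k - int n2) y2 + \<psi> (k - int n2) (R n2 x2 - y2) < meet \<phi> \<psi> k x2 + e/2" .
    define n where "n = n1 + n2"
    define z1 where "z1 = R n2 y1"
    define z2 where "z2 = R n1 y2"
    have p1: "0 \<le> z1" "z1 \<le> R n x1"
      and v1: "\<phi> (k - int n) z1 + \<psi> (k - int n) (R n x1 - z1)
        = \<phi> (k - int n1) y1 + \<psi> (k - int n1) (R n1 x1 - y1)"
      using split_push[OF x(1) 1(1) 2(1) 1(2,3)] split_push_value[OF x(1) 1(1) 2(1) 1(2,3), of k]
      unfolding add.commute[of n2 n1] n_def[symmetric] z1_def[symmetric] by auto
    have p2: "0 \<le> z2" "z2 \<le> R n x2"
      and v2: "\<phi> (k - int n) z2 + \<psi> (k - int n) (R n x2 - z2)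
        = \<phi> (k - int n2) y2 + \<psi> (k - int n2) (R n2 x2 - y2)"
      using split_push[OF x(2) 2(1) 1(1) 2(2,3)] split_push_value[OF x(2) 2(1) 1(1) 2(2,3), of k]
      unfolding n_def[symmetric] z2_def[symmetric] by auto
    have n: "N0 \<le> n" using 1 by (simp add: n_def)
    have eq: "R n (x1 + x2) - (z1 + z2) = (R n x1 - z1) + (R n x2 - z2)"
      using n by (simp add: R_add algebra_simps)
    have "\<phi> (k - int n) (z1 + z2) = \<phi> (k - int n) z1 + \<phi> (k - int n) z2"
      using p1 p2 by (intro trajectory_add[OF \<phi>])
    moreover have "\<psi> (k - int n) (R n (x1 + x2) - (z1 + z2))
        = \<psi> (k - int n) (R n x1 - z1) + \<psi> (k - int n) (R n x2 - z2)"
      unfolding eq using p1 p2 by (intro trajectory_add[OF \<psi>]) auto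
    moreover have "meet \<phi> \<psi> k (x1 + x2) \<le>
        \<phi> (k - int n) (z1 + z2) + \<psi> (k - int n) (R n (x1 + x2) - (z1 + z2))"
      using n p1 p2 by (intro meet_le) (auto simp: R_add intro: add_mono)
    ultimately show "meet \<phi> \<psi> k (x1 + x2) \<le> meet \<phi> \<psi> k x1 + meet \<phi> \<psi> k x2 + e"
      using 1(4) 2(4) v1 v2 by linarith
  qed
qed

lemma meet_flow:
  assumes m: "N0 \<le> m" and x: "0 \<le> x"
  shows "meet \<phi> \<psi> (k + int m) x = meet \<phi> \<psi> k (R m x)"
proof (rule antisym)
  show "meet \<phi> \<psi> (k + int m) x \<le> meet \<phi> \<psi> k (R m x)"
  proof (rule le_meet)
    fix n y assume "N0 \<le> n" "0 \<le> y" "y \<le> R n (R m x)"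
    then show "meet \<phi> \<psi> (k + int m) x \<le> \<phi> (k - int n) y + \<psi> (k - int n) (R n (R m x) - y)"
      using m meet_le[of "n + m" y x "k + int m"] by (simp add: R_semigroup)
  qed (use m x R_nonneg in auto)
  show "meet \<phi> \<psi> k (R m x) \<le> meet \<phi> \<psi> (k + int m) x"
  proof (rule le_meet[OF x])
    fix n y assume n: "N0 \<le> n" and y: "0 \<le> y" "y \<le> R n x"
    \<comment> \<open>Pushed by \<open>N0 + m\<close>, the split of \<open>R n x\<close> seen from
      \<open>k + int m\<close> becomes a split of \<open>R (N0 + n) (R m x)\<close> seen from
      \<open>k\<close>, with unchanged value.\<close>
    have N: "N0 \<le> N0 + m" by simp
    have 1: "R (N0 + m + n) x = R (N0 + n) (R m x)"
      using n m R_semigroup[of "N0 + n" m x] by (simp add: ac_simps)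
    have 2: "k + int m - int (N0 + m + n) = k - int (N0 + n)" by simp
    have "meet \<phi> \<psi> k (R m x) \<le> \<phi> (k - int (N0 + n)) (R (N0 + m) y)
        + \<psi> (k - int (N0 + n)) (R (N0 + n) (R m x) - R (N0 + m) y)"
      using split_push[OF x n N y] unfolding 1 by (intro meet_le) auto
    then show "meet \<phi> \<psi> k (R m x)
        \<le> \<phi> (k + int m - int n) y + \<psi> (k + int m - int n) (R n x - y)"
      using split_push_value[OF x n N y, of "k + int m"] unfolding 1 2 by linarith
  qed
qed

lemma trajectory_meet: "trajectory (meet \<phi> \<psi>)"
proof -
  obtain C where C: "\<And>k x. 0 \<le> x \<Longrightarrow> \<phi> k x \<le> C * norm x"
    using trajectory_bound[OF \<phi>] by metis
  have "meet \<phi> \<psi> k x \<le> C * norm x" if "0 \<le> x" for k x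
    using C[OF that, of k] meet_below1 that unfolding below_def by (meson order_trans)
  moreover have "0 \<le> meet \<phi> \<psi> k x" if "0 \<le> x" for k x
    using that by (intro le_meet split_nonneg)
  ultimately show ?thesis
    unfolding trajectory_def by (intro conjI exI[of _ C] allI impI meet_add meet_flow)
qed

text \<open>When \<open>R n x\<close> is cut at \<open>y\<close>, one hypothesis bounds
  \<open>\<theta>\<close> on \<open>y\<close> and the other on \<open>R n x - y\<close>; the two
  contributions of \<open>\<beta>\<close> recombine to \<open>\<beta> k x\<close>. With
  \<open>\<beta>\<close> zero this says that the meet is the greatest lower bound; the general form
  serves \<open>below_sum_disjoint\<close>.\<close>

lemma below_meet_plus:
  assumes \<theta>: "trajectory \<theta>" and \<beta>: "trajectory \<beta>"
    and "\<theta> \<preceq> (\<lambda>k x. \<phi> k x + \<beta> k x)" "\<theta> \<preceq> (\<lambda>k x. \<psi> k x + \<beta> k x)"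
  shows "\<theta> \<preceq> (\<lambda>k x. meet \<phi> \<psi> k x + \<beta> k x)"
  unfolding below_def
proof (intro allI impI)
  fix k and x :: 'a assume x: "0 \<le> x"
  have "\<theta> k x - \<beta> k x \<le> meet \<phi> \<psi> k x"
  proof (rule le_meet[OF x])
    fix n y assume n: "N0 \<le> n" and y: "0 \<le> y" "y \<le> R n x"
    let ?k = "k - int n"
    have "\<theta> ?k y \<le> \<phi> ?k y + \<beta> ?k y" "\<theta> ?k (R n x - y) \<le> \<psi> ?k (R n x - y) + \<beta> ?k (R n x - y)"
      using assms(3,4) y by (auto simp: below_def)
    then show "\<theta> k x - \<beta> k x \<le> \<phi> ?k y + \<psi> ?k (R n x - y)"
      using trajectory_back[OF \<theta> n x, of k] trajectory_back[OF \<beta> n x, of k]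
        trajectory_diff[OF \<theta> y, of ?k] trajectory_diff[OF \<beta> y, of ?k] by linarith
  qed
  then show "\<theta> k x \<le> meet \<phi> \<psi> k x + \<beta> k x" by simp
qed

lemma below_meet:
  assumes \<theta>: "trajectory \<theta>" and "\<theta> \<preceq> \<phi>" "\<theta> \<preceq> \<psi>"
  shows "\<theta> \<preceq> meet \<phi> \<psi>"
  \<comment> \<open>\<open>\<lambda>k x. 0 * \<phi> k x\<close> is the zero trajectory in a form
    covered by \<open>trajectory_scale\<close>.\<close>
  using below_meet_plus[OF \<theta>, of "\<lambda>k x. 0 * \<phi> k x"] trajectory_scale[OF \<phi>, of 0] assms by simp

text \<open>A common minorant of the residues, added to the meet, is still a common minorant of
  \<open>\<phi>\<close> and \<open>\<psi>\<close>, so it vanishes. The residues are the positive and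
  negative parts of the difference of \<open>\<phi>\<close> and \<open>\<psi>\<close>.\<close>

lemma disjoint_residues:
  "disjoint (\<lambda>k x. \<phi> k x - meet \<phi> \<psi> k x) (\<lambda>k x. \<psi> k x - meet \<phi> \<psi> k x)"
  unfolding disjoint_def
proof (intro allI impI)
  fix \<theta> assume \<theta>: "trajectory \<theta>" "\<theta> \<preceq> (\<lambda>k x. \<phi> k x - meet \<phi> \<psi> k x)"
    "\<theta> \<preceq> (\<lambda>k x. \<psi> k x - meet \<phi> \<psi> k x)"
  have "(\<lambda>k x. \<theta> k x + meet \<phi> \<psi> k x) \<preceq> meet \<phi> \<psi>"
    using \<theta> trajectory_meet by (intro below_meet trajectory_sum) (auto simp: below_def le_diff_eq)
  then show "\<theta> \<preceq> (\<lambda>k x. 0)" by (simp add: below_def)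
qed

text \<open>A nearly vanishing split leaves \<open>\<phi>\<close> small on \<open>y\<close> and
  \<open>\<psi>\<close> small on the rest, where \<open>\<phi>\<close> exceeds \<open>\<psi>\<close>
  by at most \<open>D\<close> times the norm. The factor \<open>M\<close> comes from the norm of
  \<open>R n x\<close>.\<close>

lemma disjoint_norm:
  assumes disj: "disjoint \<phi> \<psi>" and x: "0 \<le> x" and D: "0 \<le> D"
    and close: "\<And>k z. 0 \<le> z \<Longrightarrow> \<phi> k z - \<psi> k z \<le> D * norm z"
  shows "\<phi> k x \<le> M * D * norm x"
proof (rule field_le_epsilon)
  fix e :: real assume e: "0 < e"
  have "meet \<phi> \<psi> \<preceq> (\<lambda>k x. 0)"
    using disjointD[OF disj trajectory_meet meet_below1 meet_below2] .
  then have "meet \<phi> \<psi> k x \<le> 0" using x by (simp add: below_def)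
  then have "meet \<phi> \<psi> k x < e" using e by linarith
  then obtain n y where n: "N0 \<le> n" and y: "0 \<le> y" "y \<le> R n x"
    and small: "\<phi> (k - int n) y + \<psi> (k - int n) (R n x - y) < e"
    using meet_approx[OF x] by blast
  let ?k = "k - int n" and ?z = "R n x - y"
  have "\<phi> k x = \<phi> ?k y + \<phi> ?k ?z"
    using trajectory_back[OF \<phi> n x, of k] trajectory_diff[OF \<phi> y, of ?k] by simp
  also have "\<phi> ?k ?z \<le> \<psi> ?k ?z + D * norm ?z" using close[of ?z ?k] y by simp
  also have "D * norm ?z \<le> D * norm (R n x)"
    using y by (intro mult_left_mono D norm_mono_nonneg) auto
  also have "\<dots> \<le> D * (M * norm x)" by (intro mult_left_mono D R_norm n)
  finally show "\<phi> k x \<le> M * D * norm x + e"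
    using small by (simp add: algebra_simps)
qed

end

text \<open>A common minorant \<open>u\<close> of the shift and \<open>\<psi>\<close> is disjoint
  from its own backward shift, which lies below \<open>\<phi>\<close>. Norm continuity keeps these
  two close, so \<open>disjoint_norm\<close> improves any bound \<open>C\<close> for
  \<open>u\<close> to \<open>M * \<epsilon> * C\<close>; repeating this gives
  \<open>u = 0\<close>.\<close>

lemma disjoint_shift:
  assumes \<phi>: "trajectory \<phi>" and \<psi>: "trajectory \<psi>" and disj: "disjoint \<phi> \<psi>"
  shows "disjoint (\<lambda>k. \<phi> (k + 1)) \<psi>"
  unfolding disjoint_def
proof (intro allI impI)
  fix u assume u: "trajectory u" and u1: "u \<preceq> (\<lambda>k. \<phi> (k + 1))" and u2: "u \<preceq> \<psi>"
  let ?v = "\<lambda>k. u (k + - 1)"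
  have v: "trajectory ?v" using trajectory_shift[OF u] .
  have v1: "?v \<preceq> \<phi>"
    unfolding below_def
  proof (intro allI impI)
    fix k and x :: 'a assume "0 \<le> x"
    with u1[unfolded below_def, rule_format, of x "k - 1"] show "u (k + - 1) x \<le> \<phi> k x" by simp
  qed
  have disj': "disjoint u ?v"
    by (rule disjoint_sym[OF disjoint_mono[OF disj v1 u2]])
  \<comment> \<open>Both values are read at the time \<open>k - 1 - int n\<close>, where they differ
    only in the argument, \<open>R (Suc n) z\<close> against \<open>R n z\<close>. The positive part
    enters because \<open>u\<close> is controlled on the cone only.\<close>
  have step: "u k z - ?v k z \<le> C * \<epsilon> * norm z"
    if z: "0 \<le> z" and C: "0 \<le> C" "\<And>k x. 0 \<le> x \<Longrightarrow> u k x \<le> C * norm x" for k z C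
  proof -
    define n where "n = max N0 N1"
    let ?k = "k - 1 - int n" and ?w = "R (Suc n) z - R n z"
    have n: "N0 \<le> n" "N0 \<le> Suc n" "N1 \<le> n" by (auto simp: n_def)
    have R: "0 \<le> R n z" "0 \<le> R (Suc n) z" using n z R_nonneg by auto
    have "R (Suc n) z \<le> R n z + pprt ?w"
    proof -
      have "?w \<le> pprt ?w" unfolding pprt_def by (rule sup_ge1)
      then show ?thesis by (simp only: diff_le_eq add.commute)
    qed
    then have "u ?k (R (Suc n) z) \<le> u ?k (R n z + pprt ?w)"
      using R by (intro trajectory_mono[OF u])
    also have "\<dots> = u ?k (R n z) + u ?k (pprt ?w)"
      using R by (intro trajectory_add[OF u]) auto
    also have "u ?k (pprt ?w) \<le> C * norm (pprt ?w)" by (intro C) simp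
    also have "\<dots> \<le> C * norm ?w" by (intro mult_left_mono norm_pprt_le C)
    also have "\<dots> \<le> C * (\<epsilon> * norm z)" by (intro mult_left_mono R_step n C)
    finally show ?thesis
      using trajectory_back[OF u n(2) z, of k] trajectory_back[OF u n(1) z, of "k - 1"]
      by (simp add: algebra_simps)
  qed
  obtain C where C: "0 \<le> C" "\<And>k x. 0 \<le> x \<Longrightarrow> u k x \<le> C * norm x"
    using trajectory_bound[OF u] by metis
  have iterate: "u k x \<le> (M * \<epsilon>) ^ j * C * norm x" if "0 \<le> x" for j k x
    using that
  proof (induction j arbitrary: k x)
    case (Suc j)
    let ?D = "(M * \<epsilon>) ^ j * C"
    have D: "0 \<le> ?D" using M_nonneg eps_nonneg C by simp
    have "u k x \<le> M * (?D * \<epsilon>) * norm x"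
      using D eps_nonneg by (intro disjoint_norm[OF u v disj' Suc.prems _ step[OF _ D Suc.IH]]) auto
    then show ?case by (simp add: algebra_simps)
  qed (use C in auto)
  show "u \<preceq> (\<lambda>k x. 0)"
    unfolding below_def
  proof (intro allI impI)
    fix k and x :: 'a assume x: "0 \<le> x"
    have "(\<lambda>j. (M * \<epsilon>) ^ j * C * norm x) \<longlonglongrightarrow> 0 * C * norm x"
      using M_eps M_nonneg eps_nonneg by (intro tendsto_intros LIMSEQ_power_zero) auto
    then show "u k x \<le> 0"
      using iterate[OF x] by (auto intro: LIMSEQ_le_const)
  qed
qed

section \<open>Closure properties of disjointness\<close>

lemma disjoint_iterate:
  assumes \<phi>: "trajectory \<phi>" and \<psi>: "trajectory \<psi>" and disj: "disjoint \<phi> \<psi>"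
  shows "disjoint (\<lambda>k. \<phi> (k + int n)) \<psi>"
proof (induction n)
  case (Suc n)
  show ?case
    using disjoint_shift[OF trajectory_shift[OF \<phi>] \<psi> Suc] by (simp add: ac_simps)
qed (use disj in simp)

text \<open>As \<open>1 \<le> c\<close>, a common minorant of the multiple and \<open>\<psi>\<close>
  stays below \<open>\<psi>\<close> when divided by \<open>c\<close>.\<close>

lemma disjoint_scale:
  assumes disj: "disjoint \<phi> \<psi>" and \<psi>: "trajectory \<psi>" and c: "1 \<le> c"
  shows "disjoint (\<lambda>k x. c * \<phi> k x) \<psi>"
  unfolding disjoint_def
proof (intro allI impI)
  fix u assume u: "trajectory u" "u \<preceq> (\<lambda>k x. c * \<phi> k x)" "u \<preceq> \<psi>"
  have "(\<lambda>k x. (1/c) * u k x) \<preceq> (\<lambda>k x. 0)"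
  proof (rule disjointD[OF disj])
    show "trajectory (\<lambda>k x. (1/c) * u k x)" using c by (intro trajectory_scale u) auto
    show "(\<lambda>k x. (1/c) * u k x) \<preceq> \<phi>"
      using u(2) c by (auto simp: below_def field_simps)
    have "(1/c) * u k x \<le> u k x" if "0 \<le> x" for k x
      using c trajectory_nonneg[OF u(1) that, of k] mult_right_mono[of 1 c "u k x"]
      by (simp add: field_simps)
    then show "(\<lambda>k x. (1/c) * u k x) \<preceq> \<psi>"
      using u(3) unfolding below_def by (meson order_trans)
  qed
  then show "u \<preceq> (\<lambda>k x. 0)"
    using c by (auto simp: below_def divide_le_0_iff)
qed

text \<open>\<open>\<phi>\<close> lies below both \<open>\<phi> + \<beta>\<close> and
  \<open>\<alpha> + \<beta>\<close>, hence below \<open>meet \<phi> \<alpha> + \<beta>\<close>,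
  whose first term vanishes.\<close>

lemma below_sum_disjoint:
  assumes \<phi>: "trajectory \<phi>" and \<alpha>: "trajectory \<alpha>" and \<beta>: "trajectory \<beta>"
    and le: "\<phi> \<preceq> (\<lambda>k x. \<alpha> k x + \<beta> k x)" and disj: "disjoint \<phi> \<alpha>"
  shows "\<phi> \<preceq> \<beta>"
proof -
  have "meet \<phi> \<alpha> \<preceq> (\<lambda>k x. 0)"
    using disjointD[OF disj trajectory_meet meet_below1 meet_below2] \<phi> \<alpha> by blast
  moreover have "\<phi> \<preceq> (\<lambda>k x. meet \<phi> \<alpha> k x + \<beta> k x)"
    using trajectory_nonneg[OF \<beta>] by (intro below_meet_plus \<phi> \<alpha> \<beta> le) (auto simp: below_def)
  ultimately show ?thesis
    unfolding below_def by (smt (verit))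
qed

lemma disjoint_add:
  assumes \<alpha>: "trajectory \<alpha>" "disjoint \<phi> \<alpha>" and \<beta>: "trajectory \<beta>" "disjoint \<phi> \<beta>"
  shows "disjoint \<phi> (\<lambda>k x. \<alpha> k x + \<beta> k x)"
  unfolding disjoint_def
proof (intro allI impI)
  fix u assume u: "trajectory u" "u \<preceq> \<phi>" "u \<preceq> (\<lambda>k x. \<alpha> k x + \<beta> k x)"
  have "disjoint u \<alpha>"
    by (rule disjoint_mono[OF \<alpha>(2) u(2) below_refl])
  then have "u \<preceq> \<beta>" by (rule below_sum_disjoint[OF u(1) \<alpha>(1) \<beta>(1) u(3)])
  then show "u \<preceq> (\<lambda>k x. 0)" by (rule disjointD[OF \<beta>(2) u(1,2)])
qed

section \<open>Comparison of a trajectory with its shift\<close>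

lemma shift_below_scale:
  assumes f: "trajectory f" and c: "1 < c"
  shows "(\<lambda>k. f (k + 1)) \<preceq> (\<lambda>k x. c * f k x)"
proof -
  let ?g = "\<lambda>k. f (k + 1)" and ?h = "\<lambda>k x. c * f k x"
  \<comment> \<open>\<open>p\<close> and \<open>q\<close> are the positive and negative parts of the
    difference of \<open>?g\<close> and \<open>?h\<close>, so they are disjoint and
    \<open>c * f\<close> exceeds the shift of \<open>f\<close> by at most \<open>q\<close>.\<close>
  define p where "p k x = ?g k x - meet ?g ?h k x" for k x
  define q where "q k x = ?h k x - meet ?g ?h k x" for k x
  have g: "trajectory ?g" by (rule trajectory_shift[OF f])
  have h: "trajectory ?h" using c by (intro trajectory_scale f) auto
  have p: "trajectory p"
    unfolding p_def by (intro trajectory_subtract g trajectory_meet h meet_below1)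
  have q: "trajectory q"
    unfolding q_def by (intro trajectory_subtract h trajectory_meet g meet_below2)
  have pq: "disjoint p q"
    using disjoint_residues[OF g h] unfolding p_def q_def .
  have "0 \<le> p k x" if "0 \<le> x" for k x using trajectory_nonneg[OF p that] .
  then have gq: "c * f k x \<le> f (k + 1) x + q k x" if "0 \<le> x" for k x
    using that unfolding p_def q_def by (smt (verit))
  \<comment> \<open>Iterating \<open>gq\<close>, the remainder becomes \<open>c\<close> times the
    old one plus the \<open>n\<close>-fold shift of \<open>q\<close>. It stays disjoint from
    \<open>p\<close>, since scaling, shifting and adding preserve disjointness.\<close>
  have "\<exists>Q. trajectory Q \<and> disjoint p Q \<and>
      (\<forall>k. \<forall>x\<ge>0. c ^ n * f k x \<le> Q k x + f (k + int n) x)" for n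
  proof (induction n)
    case 0
    have "trajectory (\<lambda>k x. 0 * f k x)" by (rule trajectory_scale[OF f]) simp
    moreover have "disjoint p (\<lambda>k x. 0 * f k x)" by (simp add: disjoint_def)
    ultimately show ?case by (intro exI[of _ "\<lambda>k x. 0 * f k x"]) auto
  next
    case (Suc n)
    then obtain Q where Q: "trajectory Q" "disjoint p Q"
      and le: "\<And>k x. 0 \<le> x \<Longrightarrow> c ^ n * f k x \<le> Q k x + f (k + int n) x" by blast
    have 1: "disjoint p (\<lambda>k x. c * Q k x)"
      using disjoint_scale[OF disjoint_sym[OF Q(2)] p, of c] c disjoint_sym by auto
    have 2: "disjoint p (\<lambda>k. q (k + int n))"
      using disjoint_iterate[OF q p disjoint_sym[OF pq]] disjoint_sym by auto
    have 3: "trajectory (\<lambda>k x. c * Q k x)" "trajectory (\<lambda>k. q (k + int n))"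
      using c by (auto intro: trajectory_scale Q trajectory_shift q)
    have "c ^ Suc n * f k x \<le> c * Q k x + q (k + int n) x + f (k + int (Suc n)) x"
      if x: "0 \<le> x" for k x
    proof -
      have "c ^ Suc n * f k x \<le> c * (Q k x + f (k + int n) x)"
        using mult_left_mono[OF le[OF x], of c k] c by (simp add: mult.assoc)
      then show ?thesis
        using gq[OF x, of "k + int n"] by (simp add: algebra_simps)
    qed
    then show ?case
      using disjoint_add[OF 3(1) 1 3(2) 2] trajectory_sum[OF 3]
      by (intro exI[of _ "\<lambda>k x. c * Q k x + q (k + int n) x"]) auto
  qed
  then have Q: "\<exists>Q. trajectory Q \<and> disjoint p Q \<and>
      (\<forall>k. \<forall>x\<ge>0. c ^ n * f k x \<le> Q k x + f (k + int n) x)" for n .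
  obtain C where C: "0 \<le> C" "\<And>k x. 0 \<le> x \<Longrightarrow> f k x \<le> C * norm x"
    using trajectory_bound[OF f] by metis
  \<comment> \<open>A common minorant \<open>u\<close> of \<open>f\<close> and \<open>p\<close> is
    disjoint from the remainder, so \<open>c ^ n * u\<close> lies below the \<open>n\<close>-fold
    shift of \<open>f\<close>, which is bounded uniformly in \<open>n\<close>. As
    \<open>1 < c\<close>, this forces \<open>u = 0\<close>.\<close>
  have "disjoint f p"
    unfolding disjoint_def
  proof (intro allI impI)
    fix u assume u: "trajectory u" "u \<preceq> f" "u \<preceq> p"
    have bound: "u k x \<le> (1/c) ^ n * C * norm x" if x: "0 \<le> x" for n k x
    proof -
      obtain Q where Q: "trajectory Q" "disjoint p Q"
        and le: "\<And>k x. 0 \<le> x \<Longrightarrow> c ^ n * f k x \<le> Q k x + f (k + int n) x"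
        using Q[of n] by blast
      have c_pow: "1 \<le> c ^ n" using c by simp
      have "disjoint u Q"
        by (rule disjoint_mono[OF Q(2) u(3) below_refl])
      then have d: "disjoint (\<lambda>k x. c ^ n * u k x) Q"
        by (rule disjoint_scale[OF _ Q(1) c_pow])
      have "c ^ n * u k x \<le> Q k x + f (k + int n) x" if "0 \<le> x" for k x
      proof -
        have "c ^ n * u k x \<le> c ^ n * f k x"
          using u(2) that c by (intro mult_left_mono) (auto simp: below_def)
        with le[OF that, of k] show ?thesis by linarith
      qed
      then have "(\<lambda>k x. c ^ n * u k x) \<preceq> (\<lambda>k x. Q k x + f (k + int n) x)"
        by (simp add: below_def)
      moreover have "trajectory (\<lambda>k x. c ^ n * u k x)"
        using c by (intro trajectory_scale u) auto
      ultimately have "(\<lambda>k x. c ^ n * u k x) \<preceq> (\<lambda>k. f (k + int n))"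
        by (rule below_sum_disjoint[OF _ Q(1) trajectory_shift[OF f] _ d, rotated])
      then have "c ^ n * u k x \<le> f (k + int n) x" using x by (simp add: below_def)
      also have "\<dots> \<le> C * norm x" using C x by blast
      finally show ?thesis using c by (simp add: field_simps)
    qed
    show "u \<preceq> (\<lambda>k x. 0)"
      unfolding below_def
    proof (intro allI impI)
      fix k and x :: 'a assume x: "0 \<le> x"
      have "(\<lambda>n. (1/c) ^ n * C * norm x) \<longlonglongrightarrow> 0 * C * norm x"
        using c by (intro tendsto_intros LIMSEQ_power_zero) auto
      then show "u k x \<le> 0"
        using bound[OF x] by (auto intro: LIMSEQ_le_const)
    qed
  qed
  \<comment> \<open>Disjointness passes to the shift of \<open>f\<close>, but \<open>p\<close> lies
    below that shift; so \<open>p\<close> is itself a common minorant and vanishes.\<close>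
  then have "disjoint ?g p" by (rule disjoint_shift[OF f p])
  moreover have "p \<preceq> ?g"
    using trajectory_nonneg[OF trajectory_meet[OF g h]] by (auto simp: below_def p_def)
  ultimately have "p \<preceq> (\<lambda>k x. 0)" by (rule disjointD[OF _ p _ below_refl])
  then have "?g k x \<le> meet ?g ?h k x" if "0 \<le> x" for k x
    using that by (auto simp: below_def p_def)
  then have "?g \<preceq> meet ?g ?h" by (simp add: below_def)
  then show ?thesis by (rule below_trans[OF _ meet_below2[OF g h]])
qed

lemma shift_below:
  assumes f: "trajectory f"
  shows "(\<lambda>k. f (k + 1)) \<preceq> f"
  unfolding below_def
proof (intro allI impI)
  fix k and x :: 'a assume x: "0 \<le> x"
  show "f (k + 1) x \<le> f k x"
  proof (rule field_le_mult_one_interval)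
    fix z :: real assume z: "0 < z" "z < 1"
    then have "f (k + 1) x \<le> (1/z) * f k x"
      using shift_below_scale[OF f, of "1/z"] x by (auto simp: below_def)
    then show "z * f (k + 1) x \<le> f k x" using z by (simp add: field_simps)
  qed
qed

text \<open>The drop \<open>g\<close> is itself a trajectory, so it decreases too and its earlier
  values are at least \<open>g k x\<close>. Summing \<open>n\<close> of them telescopes to a
  difference of two values of \<open>f\<close>, which is bounded in \<open>n\<close>; this uses
  arbitrarily negative times.\<close>

theorem trajectory_constant:
  assumes f: "trajectory f" and x: "0 \<le> x"
  shows "f (k + 1) x = f k x"
proof -
  have dec: "\<phi> (j + 1) x \<le> \<phi> j x" if "trajectory \<phi>" for \<phi> j
    using shift_below[OF that] x by (simp add: below_def)
  define g where "g k x = f k x - f (k + 1) x" for k x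
  have g: "trajectory g"
    unfolding g_def by (intro trajectory_subtract f trajectory_shift shift_below)
  have ge: "g k x \<le> g (k - int n) x" for n
  proof (induction n)
    case (Suc n)
    then show ?case using dec[OF g, of "k - int (Suc n)"] by simp
  qed simp
  have "real n * g k x \<le> f (k + 1 - int n) x - f (k + 1) x" for n
  proof (induction n)
    case (Suc n)
    then show ?case
      using ge[of n] by (simp add: algebra_simps g_def)
  qed simp
  moreover obtain C where C: "\<And>k x. 0 \<le> x \<Longrightarrow> f k x \<le> C * norm x"
    using trajectory_bound[OF f] by metis
  ultimately have "real n * g k x \<le> C * norm x" for n
    using C[OF x, of "k + 1 - int n"] trajectory_nonneg[OF f x, of "k + 1"]
    by (smt (verit))
  then have "g k x \<le> 0"
    by (meson not_le reals_Archimedean3)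
  then show ?thesis using trajectory_nonneg[OF g x, of k] by (simp add: g_def)
qed

end

section \<open>Trajectories from positive functionals\<close>

text \<open>This is the limit superior of the norms of the positive parts. It vanishes on sequences
  below zero and ignores finitely many terms, so a linear functional below it is positive and
  vanishes on eventually zero sequences.\<close>

definition limsup_pprt :: "(nat \<Rightarrow>\<^sub>C 'a::banach_lattice) \<Rightarrow> real" where
  "limsup_pprt y = Inf {c. 0 \<le> c \<and> (\<forall>\<^sub>F j in sequentially. norm (pprt (y j)) \<le> c)}"

lemma limsup_pprt_le:
  assumes "0 \<le> c" "\<forall>\<^sub>F j in sequentially. norm (pprt (apply_bcontfun y j)) \<le> c"
  shows "limsup_pprt y \<le> c"
  unfolding limsup_pprt_def using assms by (intro cInf_lower bdd_belowI[of _ 0]) auto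

lemma limsup_pprt_less:
  assumes "limsup_pprt y < c"
  shows "\<forall>\<^sub>F j in sequentially. norm (pprt (apply_bcontfun y j)) < c"
proof -
  have "norm (pprt (apply_bcontfun y j)) \<le> norm y" for j
    using norm_pprt_le norm_bounded order_trans by blast
  then have "{c. 0 \<le> c \<and> (\<forall>\<^sub>F j in sequentially. norm (pprt (apply_bcontfun y j)) \<le> c)} \<noteq> {}"
    by (intro ex_in_conv[THEN iffD1] exI[of _ "norm y"]) auto
  from cInf_lessD[OF this assms[unfolded limsup_pprt_def]]
  obtain d where "d < c" "\<forall>\<^sub>F j in sequentially. norm (pprt (apply_bcontfun y j)) \<le> d" by blast
  then show ?thesis by (auto elim!: eventually_mono)
qed

lemma limsup_pprt_nonneg: "0 \<le> limsup_pprt y"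
proof (rule ccontr)
  assume "\<not> 0 \<le> limsup_pprt y"
  then have "\<forall>\<^sub>F j in sequentially. norm (pprt (apply_bcontfun y j)) < 0"
    by (intro limsup_pprt_less) simp
  then show False by simp
qed

lemma sublinear_limsup_pprt: "sublinear (limsup_pprt :: (nat \<Rightarrow>\<^sub>C 'a::banach_lattice) \<Rightarrow> real)"
proof -
  have add: "limsup_pprt (x + y) \<le> limsup_pprt x + limsup_pprt y" for x y :: "nat \<Rightarrow>\<^sub>C 'a"
  proof (rule field_le_epsilon)
    fix e :: real assume e: "0 < e"
    have "\<forall>\<^sub>F j in sequentially. norm (pprt (apply_bcontfun x j)) < limsup_pprt x + e/2"
      "\<forall>\<^sub>F j in sequentially. norm (pprt (apply_bcontfun y j)) < limsup_pprt y + e/2"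
      using e by (auto intro!: limsup_pprt_less)
    then have "\<forall>\<^sub>F j in sequentially. norm (pprt (apply_bcontfun (x + y) j))
        \<le> limsup_pprt x + limsup_pprt y + e"
    proof eventually_elim
      case (elim j)
      have "norm (pprt (apply_bcontfun (x + y) j))
          \<le> norm (pprt (apply_bcontfun x j) + pprt (apply_bcontfun y j))"
        using pprt_add_le by (intro norm_mono_nonneg) (auto simp: plus_bcontfun.rep_eq)
      also have "\<dots> \<le> norm (pprt (apply_bcontfun x j)) + norm (pprt (apply_bcontfun y j))"
        by (rule norm_triangle_ineq)
      finally show ?case using elim by simp
    qed
    then show "limsup_pprt (x + y) \<le> limsup_pprt x + limsup_pprt y + e"
      using e limsup_pprt_nonneg[of x] limsup_pprt_nonneg[of y] by (intro limsup_pprt_le) auto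
  qed
  have scle: "limsup_pprt (c *\<^sub>R x) \<le> c * limsup_pprt x" if c: "0 < c" for c and x :: "nat \<Rightarrow>\<^sub>C 'a"
  proof (rule field_le_epsilon)
    fix e :: real assume e: "0 < e"
    have "\<forall>\<^sub>F j in sequentially. norm (pprt (apply_bcontfun x j)) < limsup_pprt x + e/c"
      using e c by (intro limsup_pprt_less) auto
    then have "\<forall>\<^sub>F j in sequentially. norm (pprt (apply_bcontfun (c *\<^sub>R x) j)) \<le> c * limsup_pprt x + e"
      by eventually_elim (use c in \<open>simp add: pprt_scaleR_pos field_simps\<close>)
    then show "limsup_pprt (c *\<^sub>R x) \<le> c * limsup_pprt x + e"
      using e c limsup_pprt_nonneg[of x] by (intro limsup_pprt_le) auto
  qed
  have sc: "limsup_pprt (c *\<^sub>R x) = c * limsup_pprt x" if c: "0 < c" for c and x :: "nat \<Rightarrow>\<^sub>C 'a"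
  proof (rule antisym[OF scle[OF c]])
    have "limsup_pprt ((1/c) *\<^sub>R c *\<^sub>R x) \<le> (1/c) * limsup_pprt (c *\<^sub>R x)"
      using c by (intro scle) auto
    then show "c * limsup_pprt x \<le> limsup_pprt (c *\<^sub>R x)"
      using c by (simp add: field_simps)
  qed
  show ?thesis unfolding sublinear_def using add sc by blast
qed

lemma tendsto_zero_limsup_pprt:
  assumes "limsup_pprt y \<le> 0" "limsup_pprt (- y) \<le> 0"
  shows "apply_bcontfun y \<longlonglongrightarrow> 0"
proof (rule tendstoI)
  fix e :: real assume e: "0 < e"
  have "\<forall>\<^sub>F j in sequentially. norm (pprt (apply_bcontfun y j)) < e/2"
    by (rule limsup_pprt_less) (use e assms in linarith)
  moreover have "\<forall>\<^sub>F j in sequentially. norm (pprt (apply_bcontfun (- y) j)) < e/2"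
    by (rule limsup_pprt_less) (use e assms in linarith)
  ultimately show "\<forall>\<^sub>F j in sequentially. dist (apply_bcontfun y j) 0 < e"
  proof eventually_elim
    case (elim j)
    have "norm (apply_bcontfun y j)
        \<le> norm (pprt (apply_bcontfun y j)) + norm (pprt (- apply_bcontfun y j))"
      using norm_triangle_ineq4 pprt_minus_pprt[of "apply_bcontfun y j"] by metis
    then show ?case using elim by (simp add: uminus_bcontfun.rep_eq)
  qed
qed

section \<open>From orbits to trajectories\<close>

context eventually_positive_powers
begin

text \<open>The orbit of \<open>x\<close> is read from index \<open>k\<close>, which may be
  negative; this produces the two-sided time. The finitely many entries before \<open>N0\<close> are
  set to 0, which keeps the sequence bounded and additive in \<open>x\<close>.\<close>

definition orbit :: "int \<Rightarrow> 'a \<Rightarrow> nat \<Rightarrow> 'a" where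
  "orbit k x j = (if int N0 \<le> int j + k then R (nat (int j + k)) x else 0)"

lemma orbit_bcontfun: "orbit k x \<in> bcontfun"
proof (rule bcontfun_normI)
  show "norm (orbit k x j) \<le> M * norm x" for j
    using R_norm[of "nat (int j + k)" x] M_nonneg by (auto simp: orbit_def)
qed simp

definition Orbit :: "int \<Rightarrow> 'a \<Rightarrow> nat \<Rightarrow>\<^sub>C 'a" where
  "Orbit k x = Bcontfun (orbit k x)"

lemma apply_Orbit [simp]: "apply_bcontfun (Orbit k x) = orbit k x"
  by (simp add: Orbit_def Bcontfun_inverse orbit_bcontfun)

lemma trajectory_functional:
  assumes lin: "linear \<Phi>" and dom: "\<And>y. \<Phi> y \<le> limsup_pprt y"
  shows "trajectory (\<lambda>k x. \<Phi> (Orbit k x))"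
  unfolding trajectory_def
proof (intro conjI allI impI)
  fix k and x y :: 'a
  have "orbit k (x + y) j = orbit k x j + orbit k y j" for j
    by (auto simp: orbit_def R_add)
  then have "Orbit k (x + y) = Orbit k x + Orbit k y"
    by (intro bcontfun_eqI) (simp add: plus_bcontfun.rep_eq)
  then show "\<Phi> (Orbit k (x + y)) = \<Phi> (Orbit k x) + \<Phi> (Orbit k y)"
    using lin by (simp add: linear_add)
next
  fix k and x :: 'a assume x: "0 \<le> x"
  have "0 \<le> orbit k x j" for j
    using x R_nonneg[of "nat (int j + k)" x] by (auto simp: orbit_def)
  then have "limsup_pprt (- Orbit k x) \<le> 0"
    by (intro limsup_pprt_le) (auto simp: uminus_bcontfun.rep_eq)
  then show "0 \<le> \<Phi> (Orbit k x)"
    using dom[of "- Orbit k x"] lin by (simp add: linear_neg)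
next
  have "\<Phi> (Orbit k x) \<le> M * norm x" for k x
  proof -
    have "norm (pprt (orbit k x j)) \<le> M * norm x" for j
    proof -
      have "norm (orbit k x j) \<le> M * norm x"
        using R_norm[of "nat (int j + k)" x] M_nonneg by (auto simp: orbit_def)
      then show ?thesis using norm_pprt_le order_trans by blast
    qed
    then have "limsup_pprt (Orbit k x) \<le> M * norm x"
      using M_nonneg by (intro limsup_pprt_le) auto
    then show ?thesis using dom[of "Orbit k x"] by linarith
  qed
  then show "\<exists>C. \<forall>k x. 0 \<le> x \<longrightarrow> \<Phi> (Orbit k x) \<le> C * norm x" by blast
next
  fix k n and x :: 'a assume n: "N0 \<le> n"
  \<comment> \<open>Near the cutoff the two sequences may differ, but from index
    \<open>N0 - k\<close> on they agree, which is all that a functional below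
    \<open>limsup_pprt\<close> sees.\<close>
  have ev: "\<forall>\<^sub>F j in sequentially. orbit (k + int n) x j = orbit k (R n x) j"
    using eventually_ge_at_top[of "nat (int N0 - k)"]
  proof eventually_elim
    case (elim j)
    then have "int N0 \<le> int j + k" by linarith
    moreover from this have "nat (int j + (k + int n)) = nat (int j + k) + n" by linarith
    moreover have "N0 \<le> nat (int j + k)" using calculation(1) by linarith
    ultimately show ?case using n by (simp add: orbit_def R_semigroup)
  qed
  let ?d = "Orbit (k + int n) x - Orbit k (R n x)"
  have "limsup_pprt ?d \<le> 0" "limsup_pprt (- ?d) \<le> 0"
    by (intro limsup_pprt_le order_refl,
        use ev in \<open>auto elim!: eventually_mono simp: minus_bcontfun.rep_eq uminus_bcontfun.rep_eq\<close>)+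
  then have "\<Phi> ?d \<le> 0" "\<Phi> (- ?d) \<le> 0" using dom order_trans by blast+
  then show "\<Phi> (Orbit (k + int n) x) = \<Phi> (Orbit k (R n x))"
    using lin by (simp add: linear_diff linear_neg)
qed

text \<open>By Hahn-Banach some dominated functional attains \<open>limsup_pprt\<close> at the
  difference of two successive orbits. It yields a trajectory, and constancy makes it vanish on that
  difference. The same holds for the negative, and general \<open>x\<close> is split into positive
  parts.\<close>

theorem R_Suc_diff_tendsto_zero: "(\<lambda>n. R (Suc n) x - R n x) \<longlonglongrightarrow> 0"
proof -
  have pos: "(\<lambda>n. R (Suc n) x - R n x) \<longlonglongrightarrow> 0" if x: "0 \<le> x" for x
  proof -
    let ?d = "Orbit 1 x - Orbit 0 x"
    have zero: "\<Phi> ?d = 0" if "linear \<Phi>" "\<And>y. \<Phi> y \<le> limsup_pprt y" for \<Phi>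
      using trajectory_constant[OF trajectory_functional[OF that] x, of 0] that(1)
      by (simp add: linear_diff)
    have "limsup_pprt y \<le> 0" if "y = ?d \<or> y = - ?d" for y
    proof -
      obtain \<Phi> where \<Phi>: "linear \<Phi>" "\<Phi> \<le> limsup_pprt" "\<Phi> y = limsup_pprt y"
        using hahn_banach_sublinear[OF sublinear_limsup_pprt] by blast
      then have "\<Phi> ?d = 0" by (intro zero) (auto simp: le_fun_def)
      then show ?thesis using that \<Phi> by (auto simp: linear_neg linear_diff)
    qed
    then have "apply_bcontfun ?d \<longlonglongrightarrow> 0"
      by (intro tendsto_zero_limsup_pprt) auto
    moreover have "\<forall>\<^sub>F n in sequentially. apply_bcontfun ?d n = R (Suc n) x - R n x"
      using eventually_ge_at_top[of N0]
      by eventually_elim (simp add: minus_bcontfun.rep_eq orbit_def nat_add_distrib)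
    ultimately show ?thesis by (rule Lim_transform_eventually)
  qed
  have "(\<lambda>n. (R (Suc n) (pprt x) - R n (pprt x)) - (R (Suc n) (pprt (- x)) - R n (pprt (- x))))
      \<longlonglongrightarrow> 0 - 0"
    by (intro tendsto_diff pos) auto
  moreover have "\<forall>\<^sub>F n in sequentially.
      (R (Suc n) (pprt x) - R n (pprt x)) - (R (Suc n) (pprt (- x)) - R n (pprt (- x)))
      = R (Suc n) x - R n x"
    using eventually_ge_at_top[of N0]
  proof eventually_elim
    case (elim n)
    then have "R n x = R n (pprt x) - R n (pprt (- x))"
      "R (Suc n) x = R (Suc n) (pprt x) - R (Suc n) (pprt (- x))"
      using R_diff[of _ "pprt x" "pprt (- x)"] pprt_minus_pprt[of x] by auto
    then show ?case by simp
  qed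
  ultimately show ?thesis by (simp add: Lim_transform_eventually)
qed

end

section \<open>Semigroups in continuous time\<close>

lemma cesaro_mean_tendsto:
  fixes y :: "real \<Rightarrow> 'b::banach"
  assumes cont: "continuous_on {0..} y" and lim: "(y \<longlongrightarrow> l) at_top"
  shows "((\<lambda>t. (1 / t) *\<^sub>R integral {0..t} y) \<longlongrightarrow> l) at_top"
proof (rule tendstoI)
  fix e :: real assume e: "0 < e"
  have "\<forall>\<^sub>F s in at_top. dist (y s) l < e/2" using lim e by (intro tendstoD) auto
  then obtain s1 where s1: "\<And>s. s1 \<le> s \<Longrightarrow> dist (y s) l < e/2"
    by (auto simp: eventually_at_top_linorder)
  define s0 where "s0 = max 0 s1"
  define K where "K = norm (integral {0..s0} (\<lambda>s. y s - l))"
  have int: "(\<lambda>s. y s - l) integrable_on {a..b}" "y integrable_on {a..b}" if "0 \<le> a" for a b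
    using that by (auto intro!: integrable_continuous_interval continuous_intros
        intro: continuous_on_subset[OF cont])
  show "\<forall>\<^sub>F t in at_top. dist ((1 / t) *\<^sub>R integral {0..t} y) l < e"
    \<comment> \<open>Beyond \<open>2 * K / e\<close> the stretch up to \<open>s0\<close>
      contributes less than \<open>e/2\<close> to the mean.\<close>
    using eventually_gt_at_top[of "max (max s0 1) (2 * K / e)"]
  proof eventually_elim
    case (elim t)
    then have t: "s0 \<le> t" "0 < t" "2 * K / e < t" "0 \<le> s0" by (auto simp: s0_def)
    have "integral {0..t} (\<lambda>s. y s - l) = integral {0..t} y - t *\<^sub>R l"
      using int[of 0 t] t by (subst integral_diff) auto
    then have "(1 / t) *\<^sub>R integral {0..t} y - l = (1 / t) *\<^sub>R integral {0..t} (\<lambda>s. y s - l)"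
      using t by (simp add: scaleR_diff_right)
    also have "integral {0..t} (\<lambda>s. y s - l)
        = integral {0..s0} (\<lambda>s. y s - l) + integral {s0..t} (\<lambda>s. y s - l)"
      using t int by (intro Henstock_Kurzweil_Integration.integral_combine[symmetric]) auto
    also have "norm ((1 / t) *\<^sub>R \<dots>) = (1 / t) * norm \<dots>" using t by simp
    also have "\<dots> \<le> (1 / t) * (K + e/2 * (t - s0))"
    proof (intro mult_left_mono norm_triangle_le add_mono)
      show "norm (integral {s0..t} (\<lambda>s. y s - l)) \<le> e/2 * (t - s0)"
        using t s1 by (intro integral_bound continuous_intros continuous_on_subset[OF cont])
          (auto simp: s0_def dist_norm less_imp_le)
    qed (use t in \<open>auto simp: K_def\<close>)
    also have "\<dots> \<le> (1 / t) * (K + e/2 * t)"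
      using t e by (intro mult_left_mono add_left_mono) auto
    also have "\<dots> < e" using t e by (simp add: field_simps)
    finally show ?case by (simp add: dist_norm)
  qed
qed

section \<open>Cesaro means and increments of bounded semigroups\<close>

locale bounded_C0_semigroup =
  fixes T :: "real \<Rightarrow> 'b::banach \<Rightarrow> 'b" and M :: real
  assumes linear: "0 \<le> t \<Longrightarrow> bounded_linear (T t)"
    and plus: "0 \<le> s \<Longrightarrow> 0 \<le> t \<Longrightarrow> T (s + t) f = T s (T t f)"
    and continuous: "continuous_on {0..} (\<lambda>t. T t f)"
    and bound: "0 \<le> t \<Longrightarrow> norm (T t f) \<le> M * norm f"
    and M_ge_1: "1 \<le> M"
begin

lemma diff: "0 \<le> t \<Longrightarrow> T t (f - g) = T t f - T t g"
  using linear by (simp add: bounded_linear.linear linear_diff)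

lemma integrable_orbit: "(\<lambda>s. T s f) integrable_on {0..r}"
  by (rule integrable_continuous_interval) (auto intro: continuous_on_subset[OF continuous])

lemma apply_mean:
  assumes "0 \<le> t"
  shows "T t ((1 / r) *\<^sub>R integral {0..r} (\<lambda>s. T s f)) = (1 / r) *\<^sub>R integral {0..r} (\<lambda>s. T t (T s f))"
proof -
  have "integral {0..r} (T t \<circ> (\<lambda>s. T s f)) = T t (integral {0..r} (\<lambda>s. T s f))"
    using assms by (intro integral_linear integrable_orbit linear)
  then show ?thesis
    using linear[OF assms] by (simp add: o_def bounded_linear.linear linear_scale)
qed

text \<open>The limit \<open>g\<close> of the means is a fixed vector, so for one long mean
  \<open>?C r\<close> the vector \<open>T t (?C r)\<close> is close to \<open>g\<close> uniformly in
  \<open>t\<close>. And \<open>T t (?C r) - T t f\<close> is the average over \<open>s\<close> in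
  \<open>{0..r}\<close> of \<open>T t (T s f) - T t f\<close>, which tends to 0.\<close>

lemma convergent_if_mean_convergent:
  assumes shift: "\<And>s f. 0 \<le> s \<Longrightarrow> ((\<lambda>t. T (t + s) f - T t f) \<longlongrightarrow> 0) at_top"
    and mean: "((\<lambda>t. (1 / t) *\<^sub>R integral {0..t} (\<lambda>s. T s f)) \<longlongrightarrow> g) at_top"
  shows "((\<lambda>t. T t f) \<longlongrightarrow> g) at_top"
proof -
  let ?C = "\<lambda>r. (1 / r) *\<^sub>R integral {0..r} (\<lambda>s. T s f)"
  have fixed: "T u g = g" if u: "0 \<le> u" for u
  proof -
    \<comment> \<open>The increment of a mean under \<open>T u\<close> is the mean of increments
      that tend to 0 by \<open>shift\<close>.\<close>
    have eq: "T u (?C r) - ?C r = (1 / r) *\<^sub>R integral {0..r} (\<lambda>s. T (s + u) f - T s f)" for r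
    proof -
      have "integral {0..r} (\<lambda>s. T (s + u) f - T s f) = integral {0..r} (\<lambda>s. T u (T s f) - T s f)"
        using u by (intro integral_cong) (auto simp: plus[symmetric] add.commute)
      also have "\<dots> = integral {0..r} (\<lambda>s. T u (T s f)) - integral {0..r} (\<lambda>s. T s f)"
        using integrable_linear[OF integrable_orbit linear[OF u]]
        by (intro integral_diff integrable_orbit) (auto simp: o_def)
      finally show ?thesis by (simp add: apply_mean[OF u] scaleR_diff_right)
    qed
    have "continuous_on {0..} (\<lambda>s. T (s + u) f)"
      by (rule continuous_on_compose2[OF continuous]) (use u in \<open>auto intro!: continuous_intros\<close>)
    then have "continuous_on {0..} (\<lambda>s. T (s + u) f - T s f)"
      by (intro continuous_intros continuous)
    then have "((\<lambda>r. T u (?C r) - ?C r) \<longlongrightarrow> 0) at_top"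
      unfolding eq by (rule cesaro_mean_tendsto[OF _ shift[OF u]])
    moreover have "((\<lambda>r. T u (?C r) - ?C r) \<longlongrightarrow> T u g - g) at_top"
      by (intro tendsto_diff mean bounded_linear.tendsto[OF linear[OF u]])
    ultimately show ?thesis
      using tendsto_unique[OF trivial_limit_at_top_linorder] by force
  qed
  show ?thesis
  proof (rule tendstoI)
    fix e :: real assume e: "0 < e"
    have "\<forall>\<^sub>F r in at_top. dist (?C r) g < e / (4 * M)"
      using mean e M_ge_1 by (intro tendstoD) auto
    then have "\<forall>\<^sub>F r in at_top. dist (?C r) g < e / (4 * M) \<and> 0 < r"
      using eventually_gt_at_top[of 0] by eventually_elim auto
    from eventually_happens'[OF trivial_limit_at_top_linorder this]
    obtain r where r: "dist (?C r) g < e / (4 * M)" "0 < r" by blast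
    \<comment> \<open>Convergence in \<open>t\<close> is known for each \<open>s\<close> separately;
      a finite net of the compact orbit segment makes it uniform in \<open>s\<close>. The mesh
      \<open>e / (4 * M)\<close> allows for the factor \<open>M\<close> lost in applying
      \<open>T t\<close>.\<close>
    have "compact ((\<lambda>s. T s f) ` {0..r})"
      by (intro compact_continuous_image continuous_on_subset[OF continuous]) auto
    from seq_compact_imp_totally_bounded[OF compact_imp_seq_compact[OF this],
        rule_format, of "e / (4 * M)"] e M_ge_1
    obtain k where k: "finite k" "k \<subseteq> (\<lambda>s. T s f) ` {0..r}"
        "(\<lambda>s. T s f) ` {0..r} \<subseteq> (\<Union>x\<in>k. ball x (e / (4 * M)))" by auto
    have "\<forall>\<^sub>F t in at_top. dist (T t v - T t f) 0 < e/4" if "v \<in> k" for v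
    proof -
      have "v \<in> (\<lambda>s. T s f) ` {0..r}" using k(2) that by blast
      then obtain s where s: "0 \<le> s" "v = T s f" by auto
      have "\<forall>\<^sub>F t in at_top. dist (T (t + s) f - T t f) 0 < e/4"
        using e by (intro tendstoD shift s) auto
      with eventually_ge_at_top[of 0] show ?thesis
        by eventually_elim (use s in \<open>simp add: plus\<close>)
    qed
    then have "\<forall>\<^sub>F t in at_top. \<forall>v\<in>k. dist (T t v - T t f) 0 < e/4"
      using k(1) by (intro eventually_ball_finite) auto
    with eventually_ge_at_top[of 0]
    show "\<forall>\<^sub>F t in at_top. dist (T t f) g < e"
    proof eventually_elim
      case (elim t)
      have near: "norm (T t (T s f) - T t f) \<le> e/2" if s: "s \<in> {0..r}" for s
      proof -
        have "T s f \<in> (\<Union>x\<in>k. ball x (e / (4 * M)))" using k(3) s by blast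
        then obtain v where v: "v \<in> k" "dist v (T s f) < e / (4 * M)" by auto
        have "norm (T t (T s f - v)) \<le> M * norm (T s f - v)" using bound elim by blast
        also have "\<dots> \<le> M * (e / (4 * M))"
          using v M_ge_1 by (intro mult_left_mono) (auto simp: dist_norm norm_minus_commute)
        finally have "norm (T t (T s f) - T t v) \<le> e/4"
          using M_ge_1 elim by (simp add: diff)
        moreover have "norm (T t v - T t f) < e/4" using elim v by simp
        moreover have "norm (T t (T s f) - T t f) \<le> norm (T t (T s f) - T t v) + norm (T t v - T t f)"
          using norm_triangle_ineq[of "T t (T s f) - T t v" "T t v - T t f"] by simp
        ultimately show ?thesis by linarith
      qed
      have orb: "continuous_on {0..r} (\<lambda>s. T t (T s f))"
        using elim by (intro bounded_linear.continuous_on[OF linear]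
            continuous_on_subset[OF continuous]) auto
      have "integral {0..r} (\<lambda>s. T t (T s f) - T t f)
          = integral {0..r} (\<lambda>s. T t (T s f)) - r *\<^sub>R T t f"
        using r orb by (subst integral_diff) (auto intro: integrable_continuous_interval)
      then have "T t (?C r) - T t f = (1 / r) *\<^sub>R integral {0..r} (\<lambda>s. T t (T s f) - T t f)"
        using r elim by (simp add: apply_mean scaleR_diff_right)
      moreover have "norm (integral {0..r} (\<lambda>s. T t (T s f) - T t f)) \<le> e/2 * (r - 0)"
        using r near orb by (intro integral_bound continuous_intros) auto
      ultimately have 1: "norm (T t (?C r) - T t f) \<le> e/2"
        using r by (simp add: field_simps)
      have "norm (T t (?C r - g)) \<le> M * norm (?C r - g)" using bound elim by blast
      also have "\<dots> \<le> M * (e / (4 * M))"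
        using r M_ge_1 by (intro mult_left_mono) (auto simp: dist_norm)
      finally have 2: "norm (T t (?C r) - g) \<le> e/4"
        using M_ge_1 elim by (simp add: diff fixed)
      have "norm (T t f - g) \<le> norm (T t (?C r) - T t f) + norm (T t (?C r) - g)"
        using norm_triangle_ineq4[of "T t (?C r) - g" "T t (?C r) - T t f"] by simp
      then show ?case using 1 2 e by (simp add: dist_norm)
    qed
  qed
qed

text \<open>With \<open>t\<close> written as \<open>n * h + u\<close>, the increment at
  \<open>t\<close> is \<open>T u\<close> of a discrete increment, which costs a factor
  \<open>M\<close>. Multiples of \<open>h\<close> follow by applying this to
  \<open>T (real m * h) f\<close>.\<close>

lemma shift_tendsto_zero_of_step:
  assumes h: "0 < h" and step: "\<And>f. (\<lambda>n. T (real (Suc n) * h) f - T (real n * h) f) \<longlonglongrightarrow> 0"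
  shows "((\<lambda>t. T (t + real m * h) f - T t f) \<longlongrightarrow> 0) at_top"
proof (induction m)
  case (Suc m)
  define v where "v = T (real m * h) f"
  have "((\<lambda>t. T (t + h) v - T t v) \<longlongrightarrow> 0) at_top"
  proof (rule tendstoI)
    fix e :: real assume e: "0 < e"
    have "\<forall>\<^sub>F n in sequentially. dist (T (real (Suc n) * h) v - T (real n * h) v) 0 < e / M"
      using e M_ge_1 by (intro tendstoD step) auto
    then obtain N where N: "\<And>n. N \<le> n \<Longrightarrow> norm (T (real (Suc n) * h) v - T (real n * h) v) < e / M"
      by (auto simp: eventually_sequentially)
    show "\<forall>\<^sub>F t in at_top. dist (T (t + h) v - T t v) 0 < e"
      using eventually_ge_at_top[of "real N * h"]
    proof eventually_elim
      case (elim t)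
      define n where "n = nat \<lfloor>t / h\<rfloor>"
      have "real N \<le> t / h" using elim h by (simp add: field_simps)
      then have n: "N \<le> n" "real n \<le> t / h" unfolding n_def by linarith+
      define u where "u = t - real n * h"
      have u: "0 \<le> u" using n h by (simp add: u_def field_simps)
      have "T t v = T u (T (real n * h) v)" "T (t + h) v = T u (T (real (Suc n) * h) v)"
        using u h by (simp_all add: plus[symmetric]) (simp_all add: u_def algebra_simps)
      then have "norm (T (t + h) v - T t v) \<le> M * norm (T (real (Suc n) * h) v - T (real n * h) v)"
        using bound[OF u] by (simp add: diff[OF u, symmetric])
      also have "\<dots> < M * (e / M)" using N[OF n(1)] M_ge_1 by (intro mult_strict_left_mono) auto
      finally show ?case using M_ge_1 by simp
    qed
  qed
  from tendsto_add[OF this Suc]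
  have lim: "((\<lambda>t. (T (t + h) v - T t v) + (T (t + real m * h) f - T t f)) \<longlongrightarrow> 0) at_top" by simp
  have "\<forall>\<^sub>F t in at_top. (T (t + h) v - T t v) + (T (t + real m * h) f - T t f)
      = T (t + real (Suc m) * h) f - T t f"
    using eventually_ge_at_top[of 0]
  proof eventually_elim
    case (elim t)
    have "T t v = T (t + real m * h) f" "T (t + h) v = T (t + real (Suc m) * h) f"
      using elim h unfolding v_def by (simp_all add: plus[symmetric] algebra_simps)
    then show ?case by simp
  qed
  with lim show ?case by (rule Lim_transform_eventually)
qed simp

end

section \<open>Reduction to discrete time\<close>

lemma shift_tendsto_zero:
  fixes T :: "real \<Rightarrow> 'a::banach_lattice \<times> 'a \<Rightarrow> 'a \<times> 'a"
  assumes sg: "bounded_C0_semigroup T M"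
    and cscale: "\<And>t c f. 0 \<le> t \<Longrightarrow> T t (cscale c f) = cscale c (T t f)"
    and pos: "\<And>t. t0 \<le> t \<Longrightarrow> positive_op (T t)" and t0: "0 \<le> t0"
    and near: "\<And>\<epsilon>. 0 < \<epsilon> \<Longrightarrow>
      \<exists>t1\<ge>0. \<exists>\<delta>>0. \<forall>s f. 0 \<le> s \<longrightarrow> s < \<delta> \<longrightarrow> norm (T (t1 + s) f - T t1 f) \<le> \<epsilon> * norm f"
    and s: "0 \<le> s"
  shows "((\<lambda>t. T (t + s) f - T t f) \<longlongrightarrow> 0) at_top"
proof -
  interpret bounded_C0_semigroup T M by fact
  \<comment> \<open>A step has norm at most \<open>\<epsilon>\<close> at \<open>t1\<close> and
    \<open>M * \<epsilon>\<close> later, so the discrete locale is entered with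
    \<open>M * \<epsilon>\<close>. The choice makes \<open>M * (M * \<epsilon>)\<close> equal to
    1/2.\<close>
  define \<epsilon> where "\<epsilon> = 1 / (2 * M * M)"
  have \<epsilon>: "0 < \<epsilon>" "M * (M * \<epsilon>) < 1" using M_ge_1 by (auto simp: \<epsilon>_def)
  obtain t1 \<delta> where t1: "0 \<le> t1" "0 < \<delta>"
    and step: "\<And>s f. 0 \<le> s \<Longrightarrow> s < \<delta> \<Longrightarrow> norm (T (t1 + s) f - T t1 f) \<le> \<epsilon> * norm f"
    using near[OF \<epsilon>(1)] by blast
  show ?thesis
  proof (cases "s = 0")
    case False
    then have s: "0 < s" using s by simp
    obtain m :: nat where m: "s / \<delta> < real m" using reals_Archimedean2 by blast
    have "0 < s / \<delta>" using s t1 by simp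
    then have m0: "0 < real m" using m by linarith
    \<comment> \<open>\<open>m\<close> is large enough for \<open>h < \<delta>\<close>, and
      \<open>s\<close> is an exact multiple of \<open>h\<close>.\<close>
    define h where "h = s / real m"
    have h: "0 < h" "h < \<delta>" "real m * h = s"
      using s m m0 t1 by (auto simp: h_def field_simps)
    obtain N0 :: nat where "t0 / h < real N0" using reals_Archimedean2 by blast
    then have N0: "t0 \<le> real n * h" if "N0 \<le> n" for n
      using that h(1) by (smt (verit) mult_right_mono of_nat_mono pos_divide_less_eq)
    obtain N1 :: nat where "t1 / h < real N1" using reals_Archimedean2 by blast
    then have N1: "t1 \<le> real n * h" if "N1 \<le> n" for n
      using that h(1) by (smt (verit) mult_right_mono of_nat_mono pos_divide_less_eq)
    define R where "R n x = fst (T (real n * h) (x, 0))" for n and x :: 'a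
    have fst_le: "norm (fst z) \<le> norm z" for z :: "'a \<times> 'a"
      using norm_fst_le[of "fst z" "snd z"] by simp
    have nh: "0 \<le> real n * h" for n using h by simp
    have add: "T t (f + g) = T t f + T t g" if "0 \<le> t" for t f g
      using linear[OF that] by (simp add: bounded_linear.linear linear_add)
    \<comment> \<open>A positive operator sends positive vectors to real ones. As \<open>x\<close>
      is a difference of positive vectors, \<open>T t\<close> preserves the real lattice, which
      gives \<open>R\<close> its semigroup law.\<close>
    have real: "T t (x, 0) = (fst (T t (x, 0)), 0)" if t: "t0 \<le> t" for t and x :: 'a
    proof -
      have 0: "snd (T t (y, 0)) = 0" if "0 \<le> y" for y
        using pos[OF t] that by (auto simp: positive_op_def cpos_def)
      have "(x, 0) = (pprt x, 0) - (pprt (- x), 0::'a)"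
        using pprt_minus_pprt[of x] by simp
      then have "T t (x, 0) = T t (pprt x, 0) - T t (pprt (- x), 0)"
        using diff t t0 by (metis order_trans)
      then have "snd (T t (x, 0)) = 0" by (simp add: 0)
      then show ?thesis by (simp add: prod_eq_iff)
    qed
    interpret R: eventually_positive_powers R N0 N1 M "M * \<epsilon>"
    proof
      show "R n (x + y) = R n x + R n y" if "N0 \<le> n" for n x y
        using add[OF nh, of n "(x, 0)" "(y, 0)"] by (simp add: R_def)
      show "0 \<le> R n x" if "N0 \<le> n" "0 \<le> x" for n x
        using pos[OF N0[OF that(1)]] that(2) by (auto simp: positive_op_def cpos_def R_def)
      show "norm (R n x) \<le> M * norm x" for n x
        using order_trans[OF fst_le bound[OF nh, of n "(x, 0)"]]
        by (simp add: R_def norm_Pair)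
      show "R (m + n) x = R m (R n x)" if "N0 \<le> m" "N0 \<le> n" for m n x
      proof -
        have "T (real (m + n) * h) (x, 0) = T (real m * h) (T (real n * h) (x, 0))"
          using plus[OF nh nh] by (simp add: algebra_simps)
        also have "T (real n * h) (x, 0) = (R n x, 0)"
          unfolding R_def by (rule real[OF N0[OF that(2)]])
        finally show ?thesis by (simp add: R_def)
      qed
      show "norm (R (Suc n) x - R n x) \<le> M * \<epsilon> * norm x" if "N1 \<le> n" for n x
      proof -
        \<comment> \<open>\<open>u\<close> is the time elapsed since \<open>t1\<close>;
          \<open>T u\<close> carries the estimate at \<open>t1\<close> forward.\<close>
        define u where "u = real n * h - t1"
        have u: "0 \<le> u" using N1[OF that] by (simp add: u_def)
        have "T (real n * h) (x, 0) = T u (T t1 (x, 0))"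
          "T (real (Suc n) * h) (x, 0) = T u (T (t1 + h) (x, 0))"
          using u t1 h by (simp_all add: plus[symmetric]) (simp_all add: u_def algebra_simps)
        then have "R (Suc n) x - R n x = fst (T u (T (t1 + h) (x, 0) - T t1 (x, 0)))"
          by (simp add: R_def diff[OF u])
        also have "norm \<dots> \<le> norm (T u (T (t1 + h) (x, 0) - T t1 (x, 0)))" by (rule fst_le)
        also have "\<dots> \<le> M * norm (T (t1 + h) (x, 0) - T t1 (x, 0))" by (rule bound[OF u])
        also have "\<dots> \<le> M * (\<epsilon> * norm (x, 0::'a))"
          using h M_ge_1 by (intro mult_left_mono step) auto
        finally show ?thesis by (simp add: norm_Pair)
      qed
    qed (use M_ge_1 \<epsilon> in auto)
    have real_step: "(\<lambda>n. T (real (Suc n) * h) (x, 0) - T (real n * h) (x, 0)) \<longlonglongrightarrow> 0" for x :: 'a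
    proof -
      have "(\<lambda>n. (R (Suc n) x - R n x, 0::'a)) \<longlonglongrightarrow> (0, 0)"
        by (intro tendsto_Pair R.R_Suc_diff_tendsto_zero tendsto_const)
      moreover have "\<forall>\<^sub>F n in sequentially. (R (Suc n) x - R n x, 0)
          = T (real (Suc n) * h) (x, 0) - T (real n * h) (x, 0)"
        using eventually_ge_at_top[of N0]
      proof eventually_elim
        case (elim n)
        then show ?case
          using real[OF N0, of n x] real[OF N0, of "Suc n" x] by (simp add: R_def prod_eq_iff)
      qed
      ultimately show ?thesis by (simp add: zero_prod_def Lim_transform_eventually)
    qed
    have "(\<lambda>n. T (real (Suc n) * h) f - T (real n * h) f) \<longlonglongrightarrow> 0" for f
    proof -
      define D where "D n x = T (real (Suc n) * h) (x, 0) - T (real n * h) (x, 0)" for n and x :: 'a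
      \<comment> \<open>Complex linearity reduces convergence to the real and imaginary parts;
        \<open>cscale \<i>\<close> sends \<open>(x, y)\<close> to \<open>(- y, x)\<close>.\<close>
      have split: "f = (fst f, 0) + cscale \<i> (snd f, 0)" by (simp add: cscale_def prod_eq_iff)
      have "T t f = T t (fst f, 0) + cscale \<i> (T t (snd f, 0))" if "0 \<le> t" for t
        using add[OF that, of "(fst f, 0)" "cscale \<i> (snd f, 0)"] cscale[OF that] split by simp
      from this[OF nh] have "T (real (Suc n) * h) f - T (real n * h) f
          = D n (fst f) + (- snd (D n (snd f)), fst (D n (snd f)))" for n
        by (simp add: D_def cscale_def prod_eq_iff del: of_nat_Suc)
      moreover have "(\<lambda>n. D n (fst f) + (- snd (D n (snd f)), fst (D n (snd f)))) \<longlonglongrightarrow>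
          0 + (- snd (0::'a \<times> 'a), fst (0::'a \<times> 'a))"
        unfolding D_def by (intro tendsto_intros real_step)
      ultimately show ?thesis by (simp add: zero_prod_def[symmetric])
    qed
    from shift_tendsto_zero_of_step[OF h(1) this, of m f] show ?thesis by (simp only: h(3))
  qed simp
qed

section \<open>Equivalence of convergence and mean ergodicity\<close>

theorem theorem3p1:
  fixes T :: "real \<Rightarrow> 'a::banach_lattice \<times> 'a \<Rightarrow> 'a \<times> 'a"
  assumes "C0_semigroup T"
    and "uniformly_eventually_positive T"
    and "bounded_semigroup T"
    and "norm_continuous_at_infinity T"
  shows "(\<forall>f. \<exists>g. ((\<lambda>t. T t f) \<longlongrightarrow> g) at_top) \<longleftrightarrow> mean_ergodic T"
proof
  have cont: "continuous_on {0..} (\<lambda>t. T t f)" for f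
    using assms(1) unfolding C0_semigroup_def by blast
  assume "\<forall>f. \<exists>g. ((\<lambda>t. T t f) \<longlongrightarrow> g) at_top"
  then show "mean_ergodic T"
    unfolding mean_ergodic_def using cesaro_mean_tendsto[OF cont] by meson
next
  assume erg: "mean_ergodic T"
  obtain M where M: "\<And>t. 0 \<le> t \<Longrightarrow> onorm (T t) \<le> M"
    using assms(3) by (auto simp: bounded_semigroup_def)
  have lin: "bounded_linear (T t)" and cscale: "T t (cscale c f) = cscale c (T t f)"
    if "0 \<le> t" for t c f
    using assms(1) that unfolding C0_semigroup_def complex_bounded_linear_def by blast+
  \<comment> \<open>The maximum with 1 permits division by the bound.\<close>
  interpret bounded_C0_semigroup T "max 1 M"
  proof (rule bounded_C0_semigroup.intro)
    show "norm (T t f) \<le> max 1 M * norm f" if "0 \<le> t" for t f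
    proof -
      have "norm (T t f) \<le> onorm (T t) * norm f" by (rule onorm[OF lin[OF that]])
      also have "\<dots> \<le> max 1 M * norm f"
        using M[OF that] by (intro mult_right_mono) auto
      finally show ?thesis .
    qed
    show "continuous_on {0..} (\<lambda>t. T t f)" for f
      using assms(1) unfolding C0_semigroup_def by blast
    show "T (s + t) f = T s (T t f)" if "0 \<le> s" "0 \<le> t" for s t f
      using assms(1) that unfolding C0_semigroup_def by auto
  qed (rule lin, auto)
  \<comment> \<open>Boundedness excludes a positive growth bound. A negative one gives exponential
    decay to 0; a zero one makes the rescaling in norm continuity at infinity trivial, so that the
    condition concerns \<open>T\<close> itself.\<close>
  have "growth_bound T \<le> ereal 0"
    unfolding growth_bound_def using M by (intro Inf_lower) (auto intro!: exI[of _ M])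
  then consider "growth_bound T < 0" | "growth_bound T = 0" by (fastforce simp: zero_ereal_def)
  then show "\<forall>f. \<exists>g. ((\<lambda>t. T t f) \<longlongrightarrow> g) at_top"
  proof cases
    case 1
    then have "\<exists>\<omega> K. \<omega> < 0 \<and> (\<forall>t\<ge>0. onorm (T t) \<le> K * exp (\<omega> * t))"
      unfolding growth_bound_def Inf_less_iff by auto blast
    then obtain \<omega> K where w: "\<omega> < 0" "\<And>t. 0 \<le> t \<Longrightarrow> onorm (T t) \<le> K * exp (\<omega> * t)"
      by blast
    have "((\<lambda>t. T t f) \<longlongrightarrow> 0) at_top" for f
    proof (rule Lim_null_comparison)
      show "\<forall>\<^sub>F t in at_top. norm (T t f) \<le> K * exp (\<omega> * t) * norm f"
        using eventually_ge_at_top[of 0]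
      proof eventually_elim
        case (elim t)
        have "norm (T t f) \<le> onorm (T t) * norm f" by (rule onorm[OF lin[OF elim]])
        also have "\<dots> \<le> K * exp (\<omega> * t) * norm f" using w(2)[OF elim] by (intro mult_right_mono) auto
        finally show ?case .
      qed
      have "filterlim (\<lambda>t. \<omega> * t) at_bot at_top"
        using w(1) by (intro filterlim_tendsto_neg_mult_at_bot[OF tendsto_const _ filterlim_ident])
      then have "((\<lambda>t. exp (\<omega> * t)) \<longlongrightarrow> 0) at_top"
        by (rule filterlim_compose[OF exp_at_bot])
      from tendsto_mult[OF tendsto_mult[OF tendsto_const this] tendsto_const, of K "norm f"]
      show "((\<lambda>t. K * exp (\<omega> * t) * norm f) \<longlongrightarrow> 0) at_top" by simp
    qed
    then show ?thesis by blast
  next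
    case 2
    obtain t0 where t0: "0 \<le> t0" and pos: "\<And>t. t0 \<le> t \<Longrightarrow> positive_op (T t)"
      using assms(2) by (auto simp: uniformly_eventually_positive_def)
    have lim: "((\<lambda>t. Limsup (at (0::real)) (\<lambda>s. ereal (onorm (\<lambda>f. T t f - T (t + s) f)))) \<longlongrightarrow> 0) at_top"
      using assms(4) 2 by (simp add: norm_continuous_at_infinity_def)
    have near: "\<exists>t1\<ge>0. \<exists>\<delta>>0. \<forall>s f. 0 \<le> s \<longrightarrow> s < \<delta> \<longrightarrow> norm (T (t1 + s) f - T t1 f) \<le> \<epsilon> * norm f"
      if \<epsilon>: "0 < \<epsilon>" for \<epsilon>
    proof -
      have "\<forall>\<^sub>F t in at_top. Limsup (at (0::real)) (\<lambda>s. ereal (onorm (\<lambda>f. T t f - T (t + s) f))) < ereal \<epsilon>"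
        using \<epsilon> by (intro order_tendstoD(2)[OF lim]) auto
      then have "\<forall>\<^sub>F t in at_top. 0 \<le> t \<and>
          Limsup (at (0::real)) (\<lambda>s. ereal (onorm (\<lambda>f. T t f - T (t + s) f))) < ereal \<epsilon>"
        using eventually_ge_at_top[of 0] by eventually_elim auto
      from eventually_happens'[OF trivial_limit_at_top_linorder this]
      obtain t1 where t1: "0 \<le> t1"
        and "Limsup (at (0::real)) (\<lambda>s. ereal (onorm (\<lambda>f. T t1 f - T (t1 + s) f))) < ereal \<epsilon>"
        by blast
      \<comment> \<open>The filter \<open>at 0\<close> leaves out \<open>s = 0\<close>, which is why
        that case is treated separately below.\<close>
      from Limsup_lessD[OF this(2)]
      obtain \<delta> where \<delta>: "0 < \<delta>" "\<And>s. s \<noteq> 0 \<Longrightarrow> \<bar>s\<bar> < \<delta> \<Longrightarrow> onorm (\<lambda>f. T t1 f - T (t1 + s) f) < \<epsilon>"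
        by (auto simp: eventually_at dist_norm)
      have "norm (T (t1 + s) f - T t1 f) \<le> \<epsilon> * norm f" if s: "0 \<le> s" "s < \<delta>" for s f
      proof (cases "s = 0")
        case False
        have "norm (T t1 f - T (t1 + s) f) \<le> onorm (\<lambda>f. T t1 f - T (t1 + s) f) * norm f"
          using t1 s by (intro onorm bounded_linear_sub lin) auto
        also have "\<dots> \<le> \<epsilon> * norm f"
          using \<delta>(2)[of s] False s by (intro mult_right_mono) auto
        finally show ?thesis by (simp add: norm_minus_commute)
      qed (use \<epsilon> in auto)
      then show ?thesis using t1 \<delta>(1) by blast
    qed
    show ?thesis
      using erg convergent_if_mean_convergent
        shift_tendsto_zero[OF bounded_C0_semigroup_axioms cscale pos t0 near]
      unfolding mean_ergodic_def by meson
  qed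
qed

end
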